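(* Let $G$ be a metabelian $3$-group of nilpotency class $\mathrm{cl}(G)=c=m-1\ge 4$ and coclass $\mathrm{cc}(G)=r=e-1\ge 2$ with abelianization $G/G'\simeq(3,3)$. With generators $x,y$, maximal subgroups $U_1,\ldots,U_4$, and elements $\sigma_j,\tau_j$ as specified in the context, and with respect to the projection $\pi:G\to\pi(G)=G/\gamma_c(G)$ onto the parent, the restricted Artin pattern of $G$ reveals: (1) a bipolarization and partial stabilization, if the last nontrivial lower central $\gamma_{m-1}(G)$ is bicyclic and equal to the bicyclic first upper central $\zeta_1(G)$; more precisely $$\mathrm{Pol}_\pi(G)=\{1,2\},\ \mathrm{Stb}_\pi(G)=\{3,4\}\iff\gamma_{m-1}(G)=\langle\sigma_{m-1},\tau_e\rangle=\zeta_1(G);$$ (2) a unipolarization and partial stabilization, if $\gamma_{m-1}(G)$ is cyclic and $\zeta_1(G)$ is bicyclic; more precisely $$\mathrm{Pol}_\pi(G)=\{1\},\ \mathrm{Stb}_\pi(G)=\{2,3,4\}\iff\gamma_{m-1}(G)=\langle\sigma_{m-1}\rangle<\zeta_1(G)=\langle\sigma_{m-1},\tau_e\rangle;$$ (3) a nilpolarization and total stabilization, if $\gamma_{m-1}(G)$ is cyclic and equal to the cyclic $\zeta_1(G)$; more precisely $$\mathrm{Pol}_\pi(G)=\emptyset,\ \mathrm{Stb}_\pi(G)=\{1,2,3,4\}\iff\gamma_{m-1}(G)=\langle\sigma_{m-1}\rangle=\langle\tau_{e+1}\rangle=\zeta_1(G).$$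
   Context: Notation. $\gamma_1(G)=G$, $\gamma_j(G)=[\gamma_{j-1}(G),G]$ is the lower central series, $G'=\gamma_2(G)$, $\zeta_1(G)$ is the centre (first upper central), $[a,b]=a^{-1}b^{-1}ab$. $|G|=3^n$, $m$ is the index of nilpotency, $c=m-1$, coclass $r=n-c=e-1$, and $4\le m<n\le 2m-3$. "$(3,3)$" means $C_3\times C_3$. Two-step centralizers. For $2\le j\le m-1$, $\chi_j(G)$ is the biggest subgroup of $G$ with $[\chi_j(G),\gamma_j(G)]\le\gamma_{j+2}(G)$; $\chi_j(G)=G$ iff $j\ge m-1$. Put $s=s(G)=\min\{2\le j\le m-1\mid\chi_j(G)>G'\}$. Generators. According to Nebelung, $G=\langle x,y\rangle$ with $x,y$ selected such that $\gamma_3(G)=\langle y^3,x^3,\gamma_4(G)\rangle$, $x\in G\setminus\chi_s(G)$ if $s<m-1$, and $y\in\chi_s(G)\setminus G'$. The four maximal subgroups are ordered as $U_i=\langle g_i,G'\rangle$ with $g_1=y$, $g_2=x$, $g_3=xy$, $g_4=xy^{-1}$. Put $\sigma_3=y^3$, $\tau_3=x^3\in\gamma_3(G)$ and $\sigma_j=[\sigma_{j-1},x]$, $\tau_j=[\tau_{j-1},y]\in\gamma_j(G)$ for $j\ge 4$. Stabilization and polarization. With respect to the natural projection $\pi:G\to G/\gamma_c(G)$ (kernel $\gamma_c(G)=\gamma_{m-1}(G)$) and the family $(U_i)_{1\le i\le 4}$: $\mathrm{Stb}_\pi(G)=\{i\mid\ker(\pi)\le U_i'\}$ and $\mathrm{Pol}_\pi(G)=\{i\mid\ker(\pi)\not\le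 U_i'\}$. These are the indices of the components of the restricted Artin pattern $(\tau(G),\varkappa(G))=((U_i/U_i')_i,(\ker T_{G,U_i})_i)$, $T_{G,U_i}:G\to U_i/U_i'$ the Artin transfer (Verlagerung), that remain fixed, resp. change, under passage to the parent. In the paper's terms, case (1) is called an interface group and cases (2), (3) core groups. *)

theory Defs
  imports "HOL-Algebra.Algebra"
begin

(* The convention [a,b] = a^-1 b^-1 a b; the library's derived_set is built from
   a b a^-1 b^-1, which yields the same derived subgroups. *)
definition commutator :: "('a, 'b) monoid_scheme \<Rightarrow> 'a \<Rightarrow> 'a \<Rightarrow> 'a" where
  "commutator G a b = inv\<^bsub>G\<^esub> a \<otimes>\<^bsub>G\<^esub> inv\<^bsub>G\<^esub> b \<otimes>\<^bsub>G\<^esub> a \<otimes>\<^bsub>G\<^esub> b"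

definition commutator_subgroup :: "('a, 'b) monoid_scheme \<Rightarrow> 'a set \<Rightarrow> 'a set \<Rightarrow> 'a set" where
  "commutator_subgroup G H K = generate G {commutator G h k | h k. h \<in> H \<and> k \<in> K}"

(* The series starts at index 1; the value at index 0 is a dummy. *)
fun lower_central :: "('a, 'b) monoid_scheme \<Rightarrow> nat \<Rightarrow> 'a set" where
  "lower_central G 0 = carrier G"
| "lower_central G (Suc 0) = carrier G"
| "lower_central G (Suc (Suc j)) = commutator_subgroup G (lower_central G (Suc j)) (carrier G)"

definition center :: "('a, 'b) monoid_scheme \<Rightarrow> 'a set" where
  "center G = {z \<in> carrier G. \<forall>g \<in> carrier G. z \<otimes>\<^bsub>G\<^esub> g = g \<otimes>\<^bsub>G\<^esub> z}"

definition metabelian :: "('a, 'b) monoid_scheme \<Rightarrow> bool" where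
  "metabelian G \<longleftrightarrow> derived G (derived G (carrier G)) = {\<one>\<^bsub>G\<^esub>}"

definition has_nilpotency_class :: "('a, 'b) monoid_scheme \<Rightarrow> nat \<Rightarrow> bool" where
  "has_nilpotency_class G c \<longleftrightarrow>
     lower_central G (c + 1) = {\<one>\<^bsub>G\<^esub>} \<and> (\<forall>k<c. lower_central G (k + 1) \<noteq> {\<one>\<^bsub>G\<^esub>})"

definition has_coclass :: "nat \<Rightarrow> ('a, 'b) monoid_scheme \<Rightarrow> nat \<Rightarrow> bool" where
  "has_coclass p G r \<longleftrightarrow>
     (\<exists>n c. order G = p ^ n \<and> has_nilpotency_class G c \<and> n = c + r)"

(* For a subgroup H of G. The condition k dvd l (invariant factors) excludes cyclic
   groups such as C_2 x C_3. *)
definition bicyclic_subgroup :: "('a, 'b) monoid_scheme \<Rightarrow> 'a set \<Rightarrow> bool" where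
  "bicyclic_subgroup G H \<longleftrightarrow>
     (\<exists>k l. 1 < k \<and> k dvd l \<and>
        subgroup_generated G H \<cong> integer_mod_group k \<times>\<times> integer_mod_group l)"

definition cyclic_subgroup :: "('a, 'b) monoid_scheme \<Rightarrow> 'a set \<Rightarrow> bool" where
  "cyclic_subgroup G H \<longleftrightarrow> cyclic_group (subgroup_generated G H)"

(* The biggest subgroup, with respect to inclusion. It exists in every group: it is the
   centralizer of the section gamma_j / gamma_(j+2). *)
definition two_step_centralizer :: "('a, 'b) monoid_scheme \<Rightarrow> nat \<Rightarrow> 'a set" where
  "two_step_centralizer G j =
     (GREATEST H. subgroup H G \<and>
        commutator_subgroup G H (lower_central G j) \<subseteq> lower_central G (j + 2))"

(* The parameter m is the index of nilpotency. *)
definition first_two_step_centralizer :: "('a, 'b) monoid_scheme \<Rightarrow> nat \<Rightarrow> nat" where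
  "first_two_step_centralizer G m =
     Min {j \<in> {2..m - 1}. derived G (carrier G) \<subset> two_step_centralizer G j}"

definition selected_generators :: "('a, 'b) monoid_scheme \<Rightarrow> nat \<Rightarrow> 'a \<Rightarrow> 'a \<Rightarrow> bool" where
  "selected_generators G m x y \<longleftrightarrow>
     (let s = first_two_step_centralizer G m in
        x \<in> carrier G \<and> y \<in> carrier G \<and>
        carrier G = generate G {x, y} \<and>
        lower_central G 3 =
          generate G ({y [^]\<^bsub>G\<^esub> (3::nat), x [^]\<^bsub>G\<^esub> (3::nat)} \<union> lower_central G 4) \<and>
        (s < m - 1 \<longrightarrow> x \<in> carrier G - two_step_centralizer G s) \<and>
        y \<in> two_step_centralizer G s - derived G (carrier G))"

(* Only indices 1 to 4 are meaningful; U_i is generated by g_i and G'. *)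
definition maximal_subgroup ::
    "('a, 'b) monoid_scheme \<Rightarrow> 'a \<Rightarrow> 'a \<Rightarrow> nat \<Rightarrow> 'a set" where
  "maximal_subgroup G x y i =
     (let g = (if i = 1 then y
               else if i = 2 then x
               else if i = 3 then x \<otimes>\<^bsub>G\<^esub> y
               else x \<otimes>\<^bsub>G\<^esub> inv\<^bsub>G\<^esub> y)
      in generate G (insert g (derived G (carrier G))))"

(* sigma_3 = y^3, sigma_j = [sigma_(j-1), x] and tau_3 = x^3, tau_j = [tau_(j-1), y]
   for j > 3; values at indices below 3 are dummies. *)
definition sigma :: "('a, 'b) monoid_scheme \<Rightarrow> 'a \<Rightarrow> 'a \<Rightarrow> nat \<Rightarrow> 'a" where
  "sigma G x y j = ((\<lambda>a. commutator G a x) ^^ (j - 3)) (y [^]\<^bsub>G\<^esub> (3::nat))"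

definition tau :: "('a, 'b) monoid_scheme \<Rightarrow> 'a \<Rightarrow> 'a \<Rightarrow> nat \<Rightarrow> 'a" where
  "tau G x y j = ((\<lambda>a. commutator G a y) ^^ (j - 3)) (x [^]\<^bsub>G\<^esub> (3::nat))"

definition natural_projection :: "('a, 'b) monoid_scheme \<Rightarrow> 'a set \<Rightarrow> 'a \<Rightarrow> 'a set" where
  "natural_projection G N g = N #>\<^bsub>G\<^esub> g"

(* Stabilization and polarization of a family (U_i), i = 1, ..., 4, of subgroups of G with
   respect to a homomorphism phi from G to Q. *)
definition Stb ::
    "('a, 'b) monoid_scheme \<Rightarrow> ('c, 'd) monoid_scheme \<Rightarrow> ('a \<Rightarrow> 'c) \<Rightarrow> (nat \<Rightarrow> 'a set) \<Rightarrow> nat set"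
  where "Stb G Q \<phi> U = {i \<in> {1..4}. kernel G Q \<phi> \<subseteq> derived G (U i)}"

definition Pol ::
    "('a, 'b) monoid_scheme \<Rightarrow> ('c, 'd) monoid_scheme \<Rightarrow> ('a \<Rightarrow> 'c) \<Rightarrow> (nat \<Rightarrow> 'a set) \<Rightarrow> nat set"
  where "Pol G Q \<phi> U = {i \<in> {1..4}. \<not> kernel G Q \<phi> \<subseteq> derived G (U i)}"

definition nilpolarization :: "nat set \<Rightarrow> bool" where
  "nilpolarization P \<longleftrightarrow> P = {}"

definition unipolarization :: "nat set \<Rightarrow> bool" where
  "unipolarization P \<longleftrightarrow> card P = 1"

definition bipolarization :: "nat set \<Rightarrow> bool" where
  "bipolarization P \<longleftrightarrow> card P = 2"

definition partial_stabilization :: "nat set \<Rightarrow> bool" where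
  "partial_stabilization S \<longleftrightarrow> {} \<subset> S \<and> S \<subset> {1..4}"

definition total_stabilization :: "nat set \<Rightarrow> bool" where
  "total_stabilization S \<longleftrightarrow> S = {1..4}"

end

theory Submission
  imports Defs
begin

text \<open>
  Write \<open>c = m - 1\<close> for the class, so that \<open>\<gamma> c\<close> is the last non-trivial term of the lower central
  series.  Since \<open>G\<close> is metabelian, its commutator subgroup \<open>D\<close> is a module on which \<open>x - 1\<close> and
  \<open>y - 1\<close> act by \<open>\<xi> a = [a,x]\<close> and \<open>\<eta> a = [a,y]\<close>, and these two endomorphisms commute.  As
  \<open>\<sigma> 3\<close> is a power of \<open>y\<close>, it is annihilated by \<open>\<eta>\<close>, and so is the whole chain \<open>\<sigma> j\<close>; likewise
  \<open>\<xi>\<close> annihilates the chain \<open>\<tau> j\<close>.  Therefore \<open>\<gamma> j\<close> is generated by \<open>\<sigma> j\<close>, \<open>\<tau> j\<close> and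
  \<open>\<gamma> (Suc j)\<close> for all \<open>j \<ge> 3\<close> (\<open>\<Gamma>_gen\<close>), each factor of the series has exponent 3, and its order is
  3 or 9.  A dependence between \<open>\<sigma> j\<close> and \<open>\<tau> j\<close> modulo \<open>\<gamma> (Suc j)\<close> persists in later layers, so
  the order of \<open>G\<close>, that is the coclass \<open>e - 1\<close>, shows that the factors of order 9 are exactly those
  with \<open>3 \<le> j \<le> e\<close> (\<open>indep_iff\<close>).

  If \<open>e < c\<close>, the selection of the generators by two-step centralizers makes \<open>\<sigma> j\<close> generate every
  layer beyond \<open>e\<close>, so that \<open>\<xi>\<close> is there an isomorphism from each layer to the next.  As \<open>\<xi>\<close>
  annihilates \<open>\<tau> (Suc e)\<close>, this element lies in \<open>\<gamma> c\<close>, a group of order 3 (\<open>\<tau>_Suc_e_mem\<close>).  Hence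
  there are exactly three possibilities, which turn out to be those of the theorem: \<open>e = c\<close>; or
  \<open>e < c\<close> and \<open>\<tau> (Suc e)\<close> is trivial; or \<open>e < c\<close> and \<open>\<tau> (Suc e)\<close> generates \<open>\<gamma> c\<close>.

  The centre lies in \<open>D\<close> and consists of the elements annihilated by \<open>\<xi>\<close> and \<open>\<eta>\<close>; reading
  coordinates layer by layer gives it in each case (\<open>fixed_cases\<close>, \<open>center_eq\<close>).  The derived
  subgroups of the maximal subgroups \<open>U 1\<close> and \<open>U 2\<close> are the images of \<open>\<eta>\<close> and \<open>\<xi>\<close>, and those of
  \<open>U 3\<close> and \<open>U 4\<close> contain both chains from index 4 on, hence \<open>\<gamma> c\<close>: the indices 3 and 4 are always
  stable.  The image of \<open>\<xi>\<close> contains \<open>\<sigma> c\<close>, so it contains \<open>\<gamma> c\<close> if \<open>e < c\<close>, but it does not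
  contain \<open>\<tau> c\<close> if \<open>e = c\<close>.  Similarly, the image of \<open>\<eta>\<close> contains \<open>\<tau> (Suc e)\<close>, which settles the
  third case, but in the first two cases it does not contain \<open>\<sigma> c\<close>: layer by layer, a
  preimage could be moved down to \<open>\<gamma> (c - 1)\<close> if \<open>e = c\<close>, and to \<open>\<gamma> e\<close> otherwise, where \<open>\<eta>\<close>
  takes only powers of \<open>\<tau> c\<close>, respectively of the trivial element \<open>\<tau> (Suc e)\<close>, as values
  (\<open>\<Gamma>_c_image_\<eta>_iff\<close>, \<open>\<Gamma>_c_image_\<xi>_iff\<close>).
\<close>

section \<open>Adjoining elements of exponent three modulo a subgroup\<close>

context comm_group
begin

lemma subgroup_nat_pow:
  assumes "subgroup H G" "h \<in> H"
  shows "h [^] (k::nat) \<in> H"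
  by (induction k) (use assms in \<open>auto simp: subgroup.one_closed subgroup.m_closed\<close>)

lemma mult_subgroup_left_cancel:
  assumes H: "subgroup H G" and "a \<in> H" "b \<in> carrier G" "a \<otimes> b \<in> H"
  shows "b \<in> H"
proof -
  have a: "a \<in> carrier G" using assms subgroup.mem_carrier by metis
  have "inv a \<otimes> (a \<otimes> b) \<in> H" using assms by (simp add: subgroup.m_closed subgroup.m_inv_closed)
  then show ?thesis using a assms by (simp add: m_assoc[symmetric])
qed

lemma mult_subgroup_right_cancel:
  assumes "subgroup H G" "a \<in> H" "b \<in> carrier G" "b \<otimes> a \<in> H"
  shows "b \<in> H"
  using mult_subgroup_left_cancel[OF assms(1-3)] assms m_comm subgroup.mem_carrier by metis

lemma mem_if_nat_pow_mem:
  assumes "subgroup H G" "z \<in> carrier G" "z [^] (3::nat) \<in> H"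
    and "z [^] (k::nat) \<in> H" "0 < k" "k < 3"
  shows "z \<in> H"
proof -
  have "k = 1 \<or> k = 2" using assms(5,6) by auto
  then show ?thesis
  proof
    assume "k = 1"
    then show ?thesis using assms by simp
  next
    assume k: "k = 2"
    have "z [^] k \<otimes> z = z [^] (3::nat)"
      using assms(2) k by (simp add: numeral_3_eq_3 numeral_2_eq_2)
    then show ?thesis
      using assms mult_subgroup_left_cancel[of H "z [^] k" z] by simp
  qed
qed

text \<open>Since \<open>z\<close> to the third power lies in \<open>H\<close>, the exponent of \<open>z\<close> matters only modulo 3; reducing it
  to \<open>0, 1, 2\<close> gives the normal form from which all later arguments read off exponents.\<close>

lemma generate_insert_cube:
  assumes H: "subgroup H G" and z: "z \<in> carrier G" and z3: "z [^] (3::nat) \<in> H"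
  shows "generate G (insert z H) = (\<lambda>(k, h). z [^] k \<otimes> h) ` ({..<3::nat} \<times> H)"
    (is "_ = ?S")
proof -
  note sub = subgroup.mem_carrier[OF H]
  have red: "z [^] (k::nat) \<otimes> h \<in> ?S" if "h \<in> H" for k h
  proof -
    have "z [^] k = z [^] (k mod 3) \<otimes> (z [^] (3::nat)) [^] (k div 3)"
      using z by (simp add: nat_pow_pow nat_pow_mult)
    then have "z [^] k \<otimes> h = z [^] (k mod 3) \<otimes> ((z [^] (3::nat)) [^] (k div 3) \<otimes> h)"
      using z sub[OF that] by (simp add: m_assoc)
    moreover have "(z [^] (3::nat)) [^] (k div 3) \<otimes> h \<in> H"
      using H z3 that by (simp add: subgroup.m_closed subgroup_nat_pow)
    ultimately show ?thesis
      by (intro image_eqI[where x = "(k mod 3, (z [^] (3::nat)) [^] (k div 3) \<otimes> h)"]) auto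
  qed
  have "subgroup ?S G"
  proof (rule subgroupI)
    show "?S \<subseteq> carrier G" using z sub by auto
    show "?S \<noteq> {}" using subgroup.one_closed[OF H] by (auto simp: lessThan_empty_iff)
  next
    fix a assume "a \<in> ?S"
    then obtain k h where a: "a = z [^] (k::nat) \<otimes> h" and h: "h \<in> H" by auto
    have "inv a = z [^] (2 * k) \<otimes> (inv (z [^] (3 * k)) \<otimes> inv h)"
    proof -
      have "z [^] (2 * k) \<otimes> inv (z [^] (3 * k)) = inv (z [^] k)"
      proof (rule inv_equality[symmetric])
        have "z [^] (2 * k) \<otimes> inv (z [^] (3 * k)) \<otimes> z [^] k
            = (z [^] (2 * k) \<otimes> z [^] k) \<otimes> inv (z [^] (3 * k))"
          using z by (simp add: m_ac)
        also have "\<dots> = \<one>" using z by (simp add: nat_pow_mult)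
        finally show "z [^] (2 * k) \<otimes> inv (z [^] (3 * k)) \<otimes> z [^] k = \<one>" .
      qed (use z in auto)
      then show ?thesis using z sub[OF h] a by (simp add: inv_mult m_assoc[symmetric])
    qed
    moreover have "inv (z [^] (3 * k)) \<otimes> inv h \<in> H"
    proof -
      have "z [^] (3 * k) = (z [^] (3::nat)) [^] k" using z by (simp add: nat_pow_pow)
      then show ?thesis
        using H z3 h by (metis subgroup.m_closed subgroup.m_inv_closed subgroup_nat_pow)
    qed
    ultimately show "inv a \<in> ?S" using red by simp
  next
    fix a b assume "a \<in> ?S" "b \<in> ?S"
    then obtain k h k' h' where a: "a = z [^] (k::nat) \<otimes> h" and h: "h \<in> H"
      and b: "b = z [^] (k'::nat) \<otimes> h'" and h': "h' \<in> H" by auto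
    have "a \<otimes> b = z [^] (k + k') \<otimes> (h \<otimes> h')"
      using z sub[OF h] sub[OF h'] a b by (simp add: nat_pow_mult[symmetric] m_ac)
    then show "a \<otimes> b \<in> ?S" using red subgroup.m_closed[OF H h h'] by simp
  qed
  moreover have "insert z H \<subseteq> ?S"
  proof (rule insert_subsetI)
    show "z \<in> ?S" using red[OF subgroup.one_closed[OF H], of 1] z by simp
    show "H \<subseteq> ?S"
    proof
      fix h assume "h \<in> H"
      then show "h \<in> ?S" using red[of h 0] sub[of h] by simp
    qed
  qed
  ultimately have "generate G (insert z H) \<subseteq> ?S" by (intro generate_subgroup_incl)
  moreover have "?S \<subseteq> generate G (insert z H)"
  proof
    fix a assume "a \<in> ?S"
    then obtain k h where a: "a = z [^] (k::nat) \<otimes> h" and h: "h \<in> H" by auto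
    have sg: "subgroup (generate G (insert z H)) G"
      using z sub by (intro generate_is_subgroup) auto
    have "z \<in> generate G (insert z H)" "h \<in> generate G (insert z H)"
      using h by (auto intro: generate.incl)
    then show "a \<in> generate G (insert z H)"
      using sg a by (metis subgroup.m_closed subgroup_nat_pow)
  qed
  ultimately show ?thesis by blast
qed

lemma card_generate_insert_cube:
  assumes H: "subgroup H G" "finite H" and z: "z \<in> carrier G" "z [^] (3::nat) \<in> H"
    and out: "z \<notin> H"
  shows "card (generate G (insert z H)) = 3 * card H"
proof -
  note sub = subgroup.mem_carrier[OF H(1)]
  have "inj_on (\<lambda>(k, h). z [^] k \<otimes> h) ({..<3::nat} \<times> H)"
  proof -
    have le: "k = k' \<and> h = h'"
      if eq: "z [^] (k::nat) \<otimes> h = z [^] k' \<otimes> h'" and "k \<le> k'" "k' < 3" and mem: "h \<in> H" "h' \<in> H"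
      for k k' h h'
    proof -
      have "z [^] k' = z [^] k \<otimes> z [^] (k' - k)" using z \<open>k \<le> k'\<close> by (simp add: nat_pow_mult)
      with eq have "z [^] k \<otimes> h = (z [^] k \<otimes> z [^] (k' - k)) \<otimes> h'" by (simp only:)
      also have "\<dots> = z [^] k \<otimes> (z [^] (k' - k) \<otimes> h')"
        by (rule m_assoc) (simp_all add: z sub mem)
      finally have h: "h = z [^] (k' - k) \<otimes> h'"
        by (rule l_cancel) (simp_all add: z sub mem)
      with mem(1) have "z [^] (k' - k) \<otimes> h' \<in> H" by (simp only:)
      then have "z [^] (k' - k) \<in> H" using mult_subgroup_right_cancel[OF H(1) mem(2)] z by blast
      then have "\<not> 0 < k' - k" using mem_if_nat_pow_mem[OF H(1) z, of "k' - k"] out \<open>k' < 3\<close> by linarith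
      then have "k = k'" using \<open>k \<le> k'\<close> by linarith
      moreover from this have "h = h'" using h sub[OF mem(2)] by simp
      ultimately show ?thesis ..
    qed
    show ?thesis
    proof (rule inj_onI)
      fix p q
      assume pq: "p \<in> {..<3::nat} \<times> H" "q \<in> {..<3::nat} \<times> H"
        and eq: "(\<lambda>(k, h). z [^] k \<otimes> h) p = (\<lambda>(k, h). z [^] k \<otimes> h) q"
      obtain k h k' h' where p: "p = (k, h)" and q: "q = (k', h')" by fastforce
      have *: "k < 3" "h \<in> H" "k' < 3" "h' \<in> H" using pq p q by auto
      have eq: "z [^] k \<otimes> h = z [^] k' \<otimes> h'" using eq unfolding p q by (simp only: prod.case)
      show "p = q"
      proof (cases "k \<le> k'")
        case True
        show ?thesis using le[OF eq True *(3,2,4)] p q by blast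
      next
        case False
        then show ?thesis using le[OF eq[symmetric] _ *(1,4,2)] p q by fastforce
      qed
    qed
  qed
  then show ?thesis
    using H by (simp add: generate_insert_cube[OF H(1) z] card_image card_cartesian_product)
qed

text \<open>Linear independence over the field with three elements of two elements of exponent three
  in the quotient by \<open>H\<close>.\<close>

definition independent_mod :: "'a set \<Rightarrow> 'a \<Rightarrow> 'a \<Rightarrow> bool" where
  "independent_mod H u v \<longleftrightarrow> (\<forall>k<3. \<forall>l<3. u [^] (k::nat) \<otimes> v [^] (l::nat) \<in> H \<longrightarrow> k = 0 \<and> l = 0)"

lemma independent_mod_sym:
  assumes "u \<in> carrier G" "v \<in> carrier G"
  shows "independent_mod H u v \<longleftrightarrow> independent_mod H v u"
  using assms m_comm[of "u [^] _" "v [^] _"] unfolding independent_mod_def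
  by (metis nat_pow_closed)

lemma generate_insert2:
  assumes "u \<in> carrier G" "v \<in> carrier G" "H \<subseteq> carrier G"
  shows "generate G ({u, v} \<union> H) = generate G (insert u (generate G (insert v H)))"
proof
  show "generate G ({u, v} \<union> H) \<subseteq> generate G (insert u (generate G (insert v H)))"
    by (intro mono_generate) (auto intro: generate.incl)
  show "generate G (insert u (generate G (insert v H))) \<subseteq> generate G ({u, v} \<union> H)"
    using assms
    by (intro generate_subgroup_incl generate_is_subgroup insert_subsetI mono_generate)
       (auto intro: generate.incl)
qed

lemma generate_insert2_cube:
  assumes H: "subgroup H G" and u: "u \<in> carrier G" "u [^] (3::nat) \<in> H"
    and v: "v \<in> carrier G" "v [^] (3::nat) \<in> H"
    and a: "a \<in> generate G ({u, v} \<union> H)"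
  obtains k l h where "k < 3" "l < 3" "h \<in> H" "a = u [^] (k::nat) \<otimes> (v [^] (l::nat) \<otimes> h)"
proof -
  have sg: "subgroup (generate G (insert v H)) G"
    using v subgroup.subset[OF H] by (intro generate_is_subgroup) auto
  have "u [^] (3::nat) \<in> generate G (insert v H)" using u by (auto intro: generate.incl)
  from generate_insert_cube[OF sg u(1) this] generate_insert_cube[OF H v] a that
  show ?thesis
    using generate_insert2[OF u(1) v(1) subgroup.subset[OF H]] by auto
qed

text \<open>Linear independence amounts to two proper steps of adjunction, each of index three.\<close>

lemma independent_mod_iff:
  assumes H: "subgroup H G" and u: "u \<in> carrier G" "u [^] (3::nat) \<in> H"
    and v: "v \<in> carrier G" "v [^] (3::nat) \<in> H"
  shows "independent_mod H u v \<longleftrightarrow> v \<notin> H \<and> u \<notin> generate G (insert v H)"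
proof
  assume ind: "independent_mod H u v"
  have "v \<notin> H"
    using ind[unfolded independent_mod_def, rule_format, of 0 1] u v by auto
  moreover have "u \<notin> generate G (insert v H)"
  proof
    assume "u \<in> generate G (insert v H)"
    then obtain k h where k: "k < 3" "h \<in> H" "u = v [^] (k::nat) \<otimes> h"
      using generate_insert_cube[OF H v] by auto
    \<comment> \<open>Cancelling the power of \<open>v\<close> needs a complementary exponent, up to the cube of \<open>v\<close>.\<close>
    obtain l where l: "l < 3" "k + l = 0 \<or> k + l = 3"
    proof (cases "k = 0")
      case False
      then show ?thesis using that[of "3 - k"] k(1) by simp
    qed (use that[of 0] in simp)
    have "u \<otimes> v [^] l = v [^] (k + l) \<otimes> h"
      using k v subgroup.mem_carrier[OF H] by (simp add: nat_pow_mult[symmetric] m_ac)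
    also have "\<dots> \<in> H" using l k v subgroup.m_closed[OF H] subgroup.mem_carrier[OF H] by auto
    finally show False
      using ind[unfolded independent_mod_def, rule_format, of 1 l] l u by auto
  qed
  ultimately show "v \<notin> H \<and> u \<notin> generate G (insert v H)" ..
next
  assume out: "v \<notin> H \<and> u \<notin> generate G (insert v H)"
  have sg: "subgroup (generate G (insert v H)) G"
    using v subgroup.subset[OF H] by (intro generate_is_subgroup) auto
  have u3: "u [^] (3::nat) \<in> generate G (insert v H)" using u by (auto intro: generate.incl)
  show "independent_mod H u v"
    unfolding independent_mod_def
  proof (intro allI impI)
    fix k l :: nat assume kl: "k < 3" "l < 3" and mem: "u [^] k \<otimes> v [^] l \<in> H"
    have "v [^] l \<in> generate G (insert v H)"
      by (meson generate.incl insertI1 sg subgroup_nat_pow)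
    moreover have "u [^] k \<otimes> v [^] l \<in> generate G (insert v H)"
      using mem by (auto intro: generate.incl)
    ultimately have "u [^] k \<in> generate G (insert v H)"
      using mult_subgroup_right_cancel[OF sg] u by blast
    then have k: "k = 0" using mem_if_nat_pow_mem[OF sg u(1) u3] out kl by blast
    then have "v [^] l \<in> H" using mem v by simp
    then have "l = 0" using mem_if_nat_pow_mem[OF H v] out kl by blast
    with k show "k = 0 \<and> l = 0" ..
  qed
qed

text \<open>The orders of the factors of the lower central series are both computed from independence and
  used to detect it; hence the value in the dependent case is needed as well.\<close>

lemma card_generate_insert2_cube:
  assumes H: "subgroup H G" "finite H" and u: "u \<in> carrier G" "u [^] (3::nat) \<in> H"
    and v: "v \<in> carrier G" "v [^] (3::nat) \<in> H"
  shows "card (generate G ({u, v} \<union> H)) =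
    (if independent_mod H u v then 9 else if u \<in> H \<and> v \<in> H then 1 else 3) * card H"
proof -
  have sg: "subgroup (generate G (insert v H)) G"
    using v subgroup.subset[OF H(1)] by (intro generate_is_subgroup) auto
  have u3: "u [^] (3::nat) \<in> generate G (insert v H)" using u by (auto intro: generate.incl)
  have fin: "finite (generate G (insert v H))"
    using H by (simp add: generate_insert_cube[OF H(1) v])
  have mem: "generate G (insert w K) = K" if "subgroup K G" "w \<in> K" for w K
    using that generateI[OF that(1) order_refl] by (simp add: insert_absorb)
  show ?thesis
    unfolding generate_insert2[OF u(1) v(1) subgroup.subset[OF H(1)]]
      independent_mod_iff[OF H(1) u v]
    using card_generate_insert_cube[OF sg fin u(1) u3] card_generate_insert_cube[OF H v]
      mem[OF sg] mem[OF H(1)] by auto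
qed

end

context comm_group
begin

lemma subgroup_nat_pow_vimage:
  assumes "subgroup H G"
  shows "subgroup {a \<in> carrier G. a [^] (n::nat) \<in> H} G"
  by (rule subgroupI) (use assms in \<open>auto simp: subgroup.one_closed subgroup.m_closed
      subgroup.m_inv_closed nat_pow_distrib nat_pow_inv intro!: exI[of _ \<one>]\<close>)

end

lemma (in group) generate_insert_one:
  assumes "a \<in> carrier G"
  shows "generate G {a, \<one>} = generate G {a}"
  using assms by (intro equalityI mono_generate generate_subgroup_incl generate_is_subgroup)
    (auto intro: generate.incl generate.one)

lemma (in group_hom) subgroup_hom_vimage:
  assumes "subgroup K H"
  shows "subgroup {a \<in> carrier G. h a \<in> K} G"
  by (rule G.subgroupI) (use assms in \<open>auto simp: subgroup.one_closed subgroup.m_closed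
      subgroup.m_inv_closed intro!: exI[of _ \<one>]\<close>)

section \<open>Modules generated by two chains\<close>

text \<open>The commutator subgroup of \<open>G\<close> as an abelian group \<open>A\<close> on which \<open>x - 1\<close> and
  \<open>y - 1\<close> act as commuting endomorphisms \<open>\<xi>\<close> and \<open>\<eta>\<close>: here \<open>s\<close> stands for \<open>[y,x]\<close>,
  \<open>\<Gamma> j\<close> for the lower central series from its second term on, and \<open>\<sigma>\<close>, \<open>\<tau>\<close> are the two
  chains that start with the cubes of \<open>y\<close> and \<open>x\<close>.  Exchanging \<open>x\<close> and \<open>y\<close> preserves all
  hypotheses, which halves the work; the choice of \<open>y\<close> inside a two-step centralizer, which breaks this
  symmetry, enters only in a later extension.\<close>

locale two_chain_module = comm_group A for A (structure) +
  fixes \<xi> \<eta> :: "'a \<Rightarrow> 'a" and s :: 'a and \<sigma> \<tau> :: "nat \<Rightarrow> 'a" and \<Gamma> :: "nat \<Rightarrow> 'a set" and c e :: nat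
  assumes finite_carrier: "finite (carrier A)"
    and \<xi>_hom: "\<xi> \<in> hom A A" and \<eta>_hom: "\<eta> \<in> hom A A"
    and \<xi>\<eta>_commute: "a \<in> carrier A \<Longrightarrow> \<xi> (\<eta> a) = \<eta> (\<xi> a)"
    and s_closed: "s \<in> carrier A" and s_cube: "s [^] (3::nat) \<in> \<Gamma> 3"
    and \<Gamma>_2: "\<Gamma> 2 = carrier A"
    and \<Gamma>_Suc: "2 \<le> j \<Longrightarrow> \<Gamma> (Suc j) = generate A (\<xi> ` \<Gamma> j \<union> \<eta> ` \<Gamma> j)"
    and carrier_gen: "carrier A = generate A (insert s (\<Gamma> 3))"
    and \<Gamma>_3: "\<Gamma> 3 = generate A ({\<sigma> 3, \<tau> 3} \<union> \<Gamma> 4)"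
    and \<sigma>_Suc: "3 \<le> j \<Longrightarrow> \<sigma> (Suc j) = \<xi> (\<sigma> j)" and \<tau>_Suc: "3 \<le> j \<Longrightarrow> \<tau> (Suc j) = \<eta> (\<tau> j)"
    and \<eta>_\<sigma>_3: "\<eta> (\<sigma> 3) = \<one>" and \<xi>_\<tau>_3: "\<xi> (\<tau> 3) = \<one>"
    and \<Gamma>_Suc_c: "\<Gamma> (Suc c) = {\<one>}" and \<Gamma>_c: "\<Gamma> c \<noteq> {\<one>}"
    and c_ge: "4 \<le> c" and e_ge: "3 \<le> e" and e_le: "e \<le> c"
    and card_carrier: "card (carrier A) = 3 ^ (c + e - 3)"
begin

sublocale \<xi>: group_hom A A \<xi> by unfold_locales (rule \<xi>_hom)
sublocale \<eta>: group_hom A A \<eta> by unfold_locales (rule \<eta>_hom)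

lemma swapped: "two_chain_module A \<eta> \<xi> s \<tau> \<sigma> \<Gamma> c e"
  using finite_carrier \<xi>_hom \<eta>_hom \<xi>\<eta>_commute s_closed s_cube \<Gamma>_2 \<Gamma>_Suc carrier_gen \<Gamma>_3 \<sigma>_Suc \<tau>_Suc
    \<eta>_\<sigma>_3 \<xi>_\<tau>_3 \<Gamma>_Suc_c \<Gamma>_c c_ge e_ge e_le card_carrier
  by unfold_locales (simp_all add: Un_commute insert_commute)

lemma \<Gamma>_subgroup: "2 \<le> j \<Longrightarrow> subgroup (\<Gamma> j) A"
proof (induction j rule: dec_induct)
  case base
  show ?case using \<Gamma>_2 subgroup_self by simp
next
  case (step j)
  have "\<xi> ` \<Gamma> j \<union> \<eta> ` \<Gamma> j \<subseteq> carrier A"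
    using subgroup.mem_carrier[OF step.IH] by auto
  then show ?case using step.hyps \<Gamma>_Suc[of j] generate_is_subgroup by simp
qed

lemma \<Gamma>_carrier: "2 \<le> j \<Longrightarrow> a \<in> \<Gamma> j \<Longrightarrow> a \<in> carrier A"
  using subgroup.mem_carrier[OF \<Gamma>_subgroup] .

lemma finite_\<Gamma>: "2 \<le> j \<Longrightarrow> finite (\<Gamma> j)"
  using finite_subset[OF subgroup.subset[OF \<Gamma>_subgroup] finite_carrier] .

lemma card_\<Gamma>_pos: "2 \<le> j \<Longrightarrow> 0 < card (\<Gamma> j)"
  using finite_\<Gamma> subgroup.one_closed[OF \<Gamma>_subgroup] by (auto simp: card_gt_0_iff)

lemma \<xi>_\<Gamma>: "2 \<le> j \<Longrightarrow> a \<in> \<Gamma> j \<Longrightarrow> \<xi> a \<in> \<Gamma> (Suc j)"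
  and \<eta>_\<Gamma>: "2 \<le> j \<Longrightarrow> a \<in> \<Gamma> j \<Longrightarrow> \<eta> a \<in> \<Gamma> (Suc j)"
  by (auto simp: \<Gamma>_Suc intro: generate.incl)

lemma \<Gamma>_decreasing: "2 \<le> j \<Longrightarrow> \<Gamma> (Suc j) \<subseteq> \<Gamma> j"
proof (induction j rule: dec_induct)
  case base
  have "subgroup (\<Gamma> (Suc 2)) A" by (rule \<Gamma>_subgroup) simp
  then show ?case unfolding \<Gamma>_2 by (rule subgroup.subset)
next
  case (step j)
  have "generate A (\<xi> ` \<Gamma> (Suc j) \<union> \<eta> ` \<Gamma> (Suc j)) \<subseteq> generate A (\<xi> ` \<Gamma> j \<union> \<eta> ` \<Gamma> j)"
    by (intro mono_generate) (use step.IH in blast)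
  then show ?case using step.hyps \<Gamma>_Suc[of j] \<Gamma>_Suc[of "Suc j"] by simp
qed

lemma \<Gamma>_antimono:
  assumes "2 \<le> i" "i \<le> j"
  shows "\<Gamma> j \<subseteq> \<Gamma> i"
  using assms(2)
proof (induction rule: dec_induct)
  case (step n)
  then show ?case using \<Gamma>_decreasing[of n] assms(1) by auto
qed simp

lemma \<Gamma>_trivial: "c < j \<Longrightarrow> \<Gamma> j = {\<one>}"
  using \<Gamma>_antimono[of "Suc c" j] \<Gamma>_Suc_c c_ge subgroup.one_closed[OF \<Gamma>_subgroup[of j]] by auto

text \<open>\<open>\<Gamma> (Suc j)\<close> is determined by \<open>\<Gamma> j\<close>, so the series is constant once it repeats.\<close>

lemma \<Gamma>_strict:
  assumes "2 \<le> j" "j \<le> c"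
  shows "\<Gamma> (Suc j) \<noteq> \<Gamma> j"
proof
  assume eq: "\<Gamma> (Suc j) = \<Gamma> j"
  have "\<Gamma> k = \<Gamma> j" if "j \<le> k" for k
    using that
  proof (induction k rule: dec_induct)
    case (step k)
    then show ?case using \<Gamma>_Suc[of k] \<Gamma>_Suc[of j] assms eq by simp
  qed simp
  from this[of c] this[of "Suc c"] show False using assms \<Gamma>_c \<Gamma>_Suc_c by simp
qed

text \<open>The factor of \<open>\<Gamma> j\<close> by \<open>\<Gamma> (Suc j)\<close> has exponent three: this holds for the first factor because of
  \<open>s_cube\<close>, and \<open>\<xi>\<close>, \<open>\<eta>\<close> carry it from each factor to the next.\<close>

lemma cube_mem_\<Gamma>: "2 \<le> j \<Longrightarrow> a \<in> \<Gamma> j \<Longrightarrow> a [^] (3::nat) \<in> \<Gamma> (Suc j)"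
proof (induction j arbitrary: a rule: dec_induct)
  case base
  have sg: "subgroup (\<Gamma> 3) A" by (rule \<Gamma>_subgroup) simp
  have "\<Gamma> 3 \<subseteq> {a \<in> carrier A. a [^] (3::nat) \<in> \<Gamma> 3}"
    using subgroup_nat_pow[OF sg] subgroup.mem_carrier[OF sg] by auto
  then have "generate A (insert s (\<Gamma> 3)) \<subseteq> {a \<in> carrier A. a [^] (3::nat) \<in> \<Gamma> 3}"
    using s_closed s_cube by (intro generate_subgroup_incl subgroup_nat_pow_vimage sg) auto
  then show ?case using base carrier_gen \<Gamma>_2 by (auto simp: eval_nat_numeral)
next
  case (step j)
  have sg: "subgroup (\<Gamma> (Suc (Suc j))) A" using step.hyps by (intro \<Gamma>_subgroup) simp
  have "\<xi> ` \<Gamma> j \<union> \<eta> ` \<Gamma> j \<subseteq> {a \<in> carrier A. a [^] (3::nat) \<in> \<Gamma> (Suc (Suc j))}"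
    using step.IH step.hyps \<Gamma>_carrier[of j] \<xi>_\<Gamma>[of "Suc j"] \<eta>_\<Gamma>[of "Suc j"]
    by (auto simp flip: \<xi>.hom_nat_pow \<eta>.hom_nat_pow)
  then have "generate A (\<xi> ` \<Gamma> j \<union> \<eta> ` \<Gamma> j) \<subseteq> {a \<in> carrier A. a [^] (3::nat) \<in> \<Gamma> (Suc (Suc j))}"
    by (intro generate_subgroup_incl subgroup_nat_pow_vimage sg)
  then show ?case using step.prems step.hyps \<Gamma>_Suc[of j] by auto
qed

lemma \<sigma>\<tau>_mem: "3 \<le> j \<Longrightarrow> \<sigma> j \<in> \<Gamma> j \<and> \<tau> j \<in> \<Gamma> j"
proof (induction j rule: dec_induct)
  case base
  show ?case unfolding \<Gamma>_3 by (simp add: generate.incl)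
next
  case (step j)
  then show ?case using \<xi>_\<Gamma>[of j] \<eta>_\<Gamma>[of j] \<sigma>_Suc[of j] \<tau>_Suc[of j] by simp
qed

lemma \<sigma>_mem: "3 \<le> j \<Longrightarrow> \<sigma> j \<in> \<Gamma> j" and \<tau>_mem: "3 \<le> j \<Longrightarrow> \<tau> j \<in> \<Gamma> j"
  using \<sigma>\<tau>_mem by auto

lemma \<sigma>_closed: "3 \<le> j \<Longrightarrow> \<sigma> j \<in> carrier A" and \<tau>_closed: "3 \<le> j \<Longrightarrow> \<tau> j \<in> carrier A"
  using \<sigma>_mem[of j] \<tau>_mem[of j] \<Gamma>_carrier[of j] by auto

lemma \<eta>_\<sigma>: "3 \<le> j \<Longrightarrow> \<eta> (\<sigma> j) = \<one>"
proof (induction j rule: dec_induct)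
  case (step j)
  then show ?case using \<sigma>_Suc[of j] \<xi>\<eta>_commute[OF \<sigma>_closed[of j]] by (simp flip: \<xi>\<eta>_commute)
qed (rule \<eta>_\<sigma>_3)

lemma \<xi>_\<tau>: "3 \<le> j \<Longrightarrow> \<xi> (\<tau> j) = \<one>"
proof (induction j rule: dec_induct)
  case (step j)
  then show ?case using \<tau>_Suc[of j] \<xi>\<eta>_commute[OF \<tau>_closed[of j]] by simp
qed (rule \<xi>_\<tau>_3)

text \<open>The endomorphism \<open>\<xi>\<close> shifts the \<open>\<sigma>\<close>-chain and annihilates the \<open>\<tau>\<close>-chain, and \<open>\<eta>\<close> does the
  opposite, so the two chains generate all terms of the series as soon as they generate the third.\<close>

lemma \<Gamma>_gen: "3 \<le> j \<Longrightarrow> \<Gamma> j = generate A ({\<sigma> j, \<tau> j} \<union> \<Gamma> (Suc j))"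
proof (induction j rule: dec_induct)
  case base
  show ?case using \<Gamma>_3 by (simp add: eval_nat_numeral)
next
  case (step j)
  let ?N = "generate A ({\<sigma> (Suc j), \<tau> (Suc j)} \<union> \<Gamma> (Suc (Suc j)))"
  have sub: "{\<sigma> (Suc j), \<tau> (Suc j)} \<union> \<Gamma> (Suc (Suc j)) \<subseteq> \<Gamma> (Suc j)"
    using \<sigma>_mem[of "Suc j"] \<tau>_mem[of "Suc j"] \<Gamma>_decreasing[of "Suc j"] step.hyps by auto
  have sgN: "subgroup ?N A"
    using sub \<Gamma>_carrier[of "Suc j"] step.hyps by (intro generate_is_subgroup) auto
  have "{\<sigma> j, \<tau> j} \<union> \<Gamma> (Suc j) \<subseteq> {a \<in> carrier A. \<xi> a \<in> ?N}"
    using step.hyps \<xi>_\<Gamma>[of "Suc j"] \<Gamma>_carrier[of "Suc j"] \<sigma>_closed[of j] \<tau>_closed[of j]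
      \<sigma>_Suc[of j] \<xi>_\<tau>[of j]
    by (auto intro: generate.incl generate.one)
  then have "generate A ({\<sigma> j, \<tau> j} \<union> \<Gamma> (Suc j)) \<subseteq> {a \<in> carrier A. \<xi> a \<in> ?N}"
    by (intro generate_subgroup_incl \<xi>.subgroup_hom_vimage sgN)
  then have X: "\<xi> ` \<Gamma> j \<subseteq> ?N" using step.IH by blast
  have "{\<sigma> j, \<tau> j} \<union> \<Gamma> (Suc j) \<subseteq> {a \<in> carrier A. \<eta> a \<in> ?N}"
    using step.hyps \<eta>_\<Gamma>[of "Suc j"] \<Gamma>_carrier[of "Suc j"] \<sigma>_closed[of j] \<tau>_closed[of j]
      \<tau>_Suc[of j] \<eta>_\<sigma>[of j]
    by (auto intro: generate.incl generate.one)
  then have "generate A ({\<sigma> j, \<tau> j} \<union> \<Gamma> (Suc j)) \<subseteq> {a \<in> carrier A. \<eta> a \<in> ?N}"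
    by (intro generate_subgroup_incl \<eta>.subgroup_hom_vimage sgN)
  then have Y: "\<eta> ` \<Gamma> j \<subseteq> ?N" using step.IH by blast
  have "\<Gamma> (Suc j) \<subseteq> ?N"
    using \<Gamma>_Suc[of j] step.hyps generate_subgroup_incl[OF _ sgN] X Y by auto
  moreover have "?N \<subseteq> \<Gamma> (Suc j)"
    using step.hyps by (intro generate_subgroup_incl sub \<Gamma>_subgroup) simp
  ultimately show ?case by blast
qed

lemma \<sigma>_cube: "3 \<le> j \<Longrightarrow> \<sigma> j [^] (3::nat) \<in> \<Gamma> (Suc j)"
  and \<tau>_cube: "3 \<le> j \<Longrightarrow> \<tau> j [^] (3::nat) \<in> \<Gamma> (Suc j)"
  using cube_mem_\<Gamma>[of j] \<sigma>_mem[of j] \<tau>_mem[of j] by auto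

lemma \<Gamma>_decompose:
  assumes "3 \<le> j" "a \<in> \<Gamma> j"
  obtains k l b where "k < 3" "l < 3" "b \<in> \<Gamma> (Suc j)"
    "a = \<sigma> j [^] (k::nat) \<otimes> (\<tau> j [^] (l::nat) \<otimes> b)"
proof -
  have a: "a \<in> generate A ({\<sigma> j, \<tau> j} \<union> \<Gamma> (Suc j))" using assms \<Gamma>_gen[of j] by simp
  have sg: "subgroup (\<Gamma> (Suc j)) A" using assms by (intro \<Gamma>_subgroup) simp
  show ?thesis
    using generate_insert2_cube[OF sg \<sigma>_closed[OF assms(1)] \<sigma>_cube[OF assms(1)]
        \<tau>_closed[OF assms(1)] \<tau>_cube[OF assms(1)] a] that by blast
qed

lemma \<xi>\<eta>_decomposed:
  assumes "3 \<le> j" "b \<in> carrier A"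
  shows "\<xi> (\<sigma> j [^] (k::nat) \<otimes> (\<tau> j [^] (l::nat) \<otimes> b)) = \<sigma> (Suc j) [^] k \<otimes> \<xi> b"
    and "\<eta> (\<sigma> j [^] k \<otimes> (\<tau> j [^] l \<otimes> b)) = \<tau> (Suc j) [^] l \<otimes> \<eta> b"
  using assms \<sigma>_closed[of j] \<tau>_closed[of j] \<xi>_\<tau>[of j] \<eta>_\<sigma>[of j] \<sigma>_Suc[of j] \<tau>_Suc[of j]
  by (simp_all add: \<xi>.hom_nat_pow \<eta>.hom_nat_pow)

text \<open>Peeling one layer off an element of the image of \<open>\<eta>\<close>: only the \<open>\<tau>\<close>-coordinate of the layer
  contributes to the image.\<close>

lemma image_\<eta>_descend:
  assumes "3 \<le> j" "a \<in> \<eta> ` \<Gamma> j" "a \<in> \<Gamma> (Suc (Suc j))"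
  obtains l b where "l < 3" "b \<in> \<Gamma> (Suc j)" "\<tau> (Suc j) [^] (l::nat) \<in> \<Gamma> (Suc (Suc j))"
    "a = \<tau> (Suc j) [^] l \<otimes> \<eta> b"
proof -
  obtain d where d: "d \<in> \<Gamma> j" "a = \<eta> d" using assms(2) by blast
  obtain k l b where kl: "k < 3" "l < 3" and b: "b \<in> \<Gamma> (Suc j)"
    and eq: "d = \<sigma> j [^] (k::nat) \<otimes> (\<tau> j [^] (l::nat) \<otimes> b)"
    using \<Gamma>_decompose[OF assms(1) d(1)] by metis
  have sg: "subgroup (\<Gamma> (Suc (Suc j))) A" using assms(1) by (intro \<Gamma>_subgroup) simp
  have bc: "b \<in> carrier A" using b \<Gamma>_carrier[of "Suc j"] assms(1) by simp
  have a: "a = \<tau> (Suc j) [^] l \<otimes> \<eta> b"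
    using d(2) \<xi>\<eta>_decomposed(2)[OF assms(1) bc] eq by simp
  have "\<eta> b \<in> \<Gamma> (Suc (Suc j))" using \<eta>_\<Gamma>[of "Suc j" b] b assms(1) by simp
  then have "\<tau> (Suc j) [^] l \<in> \<Gamma> (Suc (Suc j))"
    using mult_subgroup_right_cancel[OF sg, of "\<eta> b" "\<tau> (Suc j) [^] l"]
      assms(3) a \<tau>_closed[of "Suc j"] assms(1) by simp
  then show ?thesis using that kl(2) b a by blast
qed

abbreviation indep :: "nat \<Rightarrow> bool" where
  "indep j \<equiv> independent_mod (\<Gamma> (Suc j)) (\<sigma> j) (\<tau> j)"

text \<open>A dependence between \<open>\<sigma> j\<close> and \<open>\<tau> j\<close> modulo \<open>\<Gamma> (Suc j)\<close> is passed on to the next layer: apply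
  \<open>\<xi>\<close> to retain its \<open>\<sigma>\<close>-part, or \<open>\<eta>\<close> to retain its \<open>\<tau>\<close>-part.\<close>

lemma indep_descend:
  assumes "3 \<le> j" "indep (Suc j)"
  shows "indep j"
  unfolding independent_mod_def
proof (intro allI impI)
  fix k l :: nat
  assume kl: "k < 3" "l < 3" and mem: "\<sigma> j [^] k \<otimes> \<tau> j [^] l \<in> \<Gamma> (Suc j)"
  have eq: "\<sigma> j [^] k \<otimes> (\<tau> j [^] l \<otimes> \<one>) = \<sigma> j [^] k \<otimes> \<tau> j [^] l"
    using \<tau>_closed[OF assms(1)] by simp
  have cl: "\<sigma> (Suc j) \<in> carrier A" "\<tau> (Suc j) \<in> carrier A"
    using \<sigma>_closed[of "Suc j"] \<tau>_closed[of "Suc j"] assms(1) by simp_all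
  have "\<xi> (\<sigma> j [^] k \<otimes> \<tau> j [^] l) = \<sigma> (Suc j) [^] k \<otimes> \<tau> (Suc j) [^] (0::nat)"
    "\<eta> (\<sigma> j [^] k \<otimes> \<tau> j [^] l) = \<sigma> (Suc j) [^] (0::nat) \<otimes> \<tau> (Suc j) [^] l"
    using \<xi>\<eta>_decomposed[OF assms(1) one_closed, of k l] cl unfolding eq by simp_all
  moreover have "\<xi> (\<sigma> j [^] k \<otimes> \<tau> j [^] l) \<in> \<Gamma> (Suc (Suc j))"
    "\<eta> (\<sigma> j [^] k \<otimes> \<tau> j [^] l) \<in> \<Gamma> (Suc (Suc j))"
    using \<xi>_\<Gamma>[of "Suc j"] \<eta>_\<Gamma>[of "Suc j"] mem assms(1) by simp_all
  ultimately have "\<sigma> (Suc j) [^] k \<otimes> \<tau> (Suc j) [^] (0::nat) \<in> \<Gamma> (Suc (Suc j))"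
    "\<sigma> (Suc j) [^] (0::nat) \<otimes> \<tau> (Suc j) [^] l \<in> \<Gamma> (Suc (Suc j))" by simp_all
  then show "k = 0 \<and> l = 0"
    using assms(2)[unfolded independent_mod_def, rule_format, of k 0]
      assms(2)[unfolded independent_mod_def, rule_format, of 0 l] kl by simp
qed

lemma indep_antimono:
  assumes "3 \<le> i" "i \<le> j" "indep j"
  shows "indep i"
  using assms(2)
proof (induction rule: inc_induct)
  case (step n)
  then show ?case using indep_descend[of n] assms(1) by simp
qed (rule assms(3))

lemma card_\<Gamma>_step:
  assumes "3 \<le> j" "j \<le> c"
  shows "card (\<Gamma> j) = (if indep j then 9 else 3) * card (\<Gamma> (Suc j))"
proof -
  have sg: "subgroup (\<Gamma> (Suc j)) A" using assms by (intro \<Gamma>_subgroup) simp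
  have "\<not> (\<sigma> j \<in> \<Gamma> (Suc j) \<and> \<tau> j \<in> \<Gamma> (Suc j))"
  proof
    assume "\<sigma> j \<in> \<Gamma> (Suc j) \<and> \<tau> j \<in> \<Gamma> (Suc j)"
    then have "\<Gamma> j \<subseteq> \<Gamma> (Suc j)"
      using \<Gamma>_gen[OF assms(1)] generate_subgroup_incl[OF _ sg] by auto
    then show False using \<Gamma>_strict[of j] \<Gamma>_decreasing[of j] assms by auto
  qed
  then show ?thesis
    using card_generate_insert2_cube[OF sg finite_\<Gamma>[of "Suc j"] \<sigma>_closed[OF assms(1)]
        \<sigma>_cube[OF assms(1)] \<tau>_closed[OF assms(1)] \<tau>_cube[OF assms(1)]]
      \<Gamma>_gen[OF assms(1)] assms by auto
qed

lemma card_\<Gamma>: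
  assumes "3 \<le> j" "j \<le> Suc c"
  shows "card (\<Gamma> j) = 3 ^ (Suc c - j + card {i \<in> {j..c}. indep i})"
  using assms(2,1)
proof (induction j rule: inc_induct)
  case base
  show ?case using \<Gamma>_Suc_c by simp
next
  case (step j)
  \<comment> \<open>Each layer contributes one factor 3, and a second one if it is two-dimensional.\<close>
  have "{i \<in> {j..c}. indep i} = (if indep j then {j} else {}) \<union> {i \<in> {Suc j..c}. indep i}"
    using step.hyps by (auto simp: not_less_eq_eq le_Suc_eq order.order_iff_strict)
  then have "card {i \<in> {j..c}. indep i} = (if indep j then 1 else 0) + card {i \<in> {Suc j..c}. indep i}"
    by (auto simp: card_insert_if)
  moreover have "Suc c - j = Suc (Suc c - Suc j)" using step.hyps by simp
  moreover have "card (\<Gamma> (Suc j)) = 3 ^ (Suc c - Suc j + card {i \<in> {Suc j..c}. indep i})"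
    using step.IH step.prems by simp
  ultimately show ?case
    using card_\<Gamma>_step[of j] step.prems step.hyps by (simp only: power_add power_Suc) simp
qed

text \<open>The order of \<open>A\<close> leaves room for exactly \<open>e - 2\<close> layers of order 9, and since independence is
  inherited by earlier layers, these are the layers \<open>3, \<dots>, e\<close>.\<close>

lemma indep_iff:
  assumes "3 \<le> j" "j \<le> c"
  shows "indep j \<longleftrightarrow> j \<le> e"
proof -
  let ?D = "{i \<in> {3..c}. indep i}"
  have sg: "subgroup (\<Gamma> 3) A" by (rule \<Gamma>_subgroup) simp
  have "s \<notin> \<Gamma> 3"
  proof
    assume "s \<in> \<Gamma> 3"
    then have "carrier A \<subseteq> \<Gamma> 3"
      using carrier_gen generate_subgroup_incl[OF _ sg, of "insert s (\<Gamma> 3)"] by simp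
    then show False
      using \<Gamma>_strict[of 2] \<Gamma>_decreasing[of 2] \<Gamma>_2 c_ge by (simp add: eval_nat_numeral)
  qed
  then have "card (carrier A) = 3 * card (\<Gamma> 3)"
    using card_generate_insert_cube[OF sg finite_\<Gamma> s_closed s_cube] carrier_gen by simp
  also have "\<dots> = 3 ^ (Suc (Suc c - 3 + card ?D))" using card_\<Gamma>[of 3] c_ge by simp
  finally have "(3::nat) ^ (c + e - 3) = 3 ^ Suc (Suc c - 3 + card ?D)" using card_carrier by simp
  then have "c + e - 3 = Suc (Suc c - 3 + card ?D)" by (subst (asm) power_inject_exp) simp_all
  then have D: "card ?D = e - 2" using c_ge e_ge by linarith
  show ?thesis
  proof
    assume "indep j"
    then have "{3..j} \<subseteq> ?D" using assms indep_antimono[of _ j] by auto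
    then have "card {3..j} \<le> card ?D" by (intro card_mono) auto
    then show "j \<le> e" using D e_ge assms by simp
  next
    assume "j \<le> e"
    show "indep j"
    proof (rule ccontr)
      assume "\<not> indep j"
      then have "\<not> j \<le> i" if "indep i" for i using indep_antimono[OF assms(1) _ that] by blast
      then have "?D \<subseteq> {3..<j}" by (auto simp: not_le)
      then have "card ?D \<le> card {3..<j}" by (rule card_mono[OF finite_atLeastLessThan])
      then show False using D e_ge assms(1) \<open>j \<le> e\<close> unfolding card_atLeastLessThan by linarith
    qed
  qed
qed

lemma indepD:
  assumes "3 \<le> j" "j \<le> e" "\<sigma> j [^] (k::nat) \<otimes> \<tau> j [^] (l::nat) \<in> \<Gamma> (Suc j)" "k < 3" "l < 3"
  shows "k = 0" "l = 0"
  using indep_iff[of j] assms e_le unfolding independent_mod_def by auto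

lemma \<sigma>_powD:
  assumes "3 \<le> j" "j \<le> e" "\<sigma> j [^] (k::nat) \<in> \<Gamma> (Suc j)" "k < 3"
  shows "k = 0"
  using indepD[of j k 0] assms \<sigma>_closed[of j] by simp

lemma \<tau>_powD:
  assumes "3 \<le> j" "j \<le> e" "\<tau> j [^] (k::nat) \<in> \<Gamma> (Suc j)" "k < 3"
  shows "k = 0"
  using indepD[of j 0 k] assms \<tau>_closed[of j] by simp

text \<open>The elements \<open>\<xi> s\<close> and \<open>\<eta> s\<close> generate \<open>\<Gamma> 3\<close> modulo \<open>\<Gamma> 4\<close>, and this factor has order 9 because
  \<open>e\<close> is at least 3.\<close>

lemma \<xi>_s_\<eta>_s_independent: "independent_mod (\<Gamma> 4) (\<xi> s) (\<eta> s)"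
proof (rule ccontr)
  assume dep: "\<not> independent_mod (\<Gamma> 4) (\<xi> s) (\<eta> s)"
  have sg: "subgroup (\<Gamma> 4) A" by (rule \<Gamma>_subgroup) simp
  have X: "\<xi> a \<in> \<Gamma> 3" and Y: "\<eta> a \<in> \<Gamma> 3" if "a \<in> carrier A" for a
    using \<xi>_\<Gamma>[of 2 a] \<eta>_\<Gamma>[of 2 a] that \<Gamma>_2 by (simp_all add: eval_nat_numeral)
  have X4: "\<xi> a \<in> \<Gamma> 4" and Y4: "\<eta> a \<in> \<Gamma> 4" and c4: "a [^] (3::nat) \<in> \<Gamma> 4" if "a \<in> \<Gamma> 3" for a
    using \<xi>_\<Gamma>[of 3 a] \<eta>_\<Gamma>[of 3 a] cube_mem_\<Gamma>[of 3 a] that by (simp_all add: eval_nat_numeral)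
  let ?N = "generate A ({\<xi> s, \<eta> s} \<union> \<Gamma> 4)"
  have sgN: "subgroup ?N A"
    using s_closed subgroup.subset[OF sg] by (intro generate_is_subgroup) auto
  have "generate A (insert s (\<Gamma> 3)) \<subseteq> {a \<in> carrier A. \<xi> a \<in> ?N}"
    using s_closed \<Gamma>_carrier[of 3]
    by (intro generate_subgroup_incl \<xi>.subgroup_hom_vimage sgN) (auto intro: generate.incl X4)
  moreover have "generate A (insert s (\<Gamma> 3)) \<subseteq> {a \<in> carrier A. \<eta> a \<in> ?N}"
    using s_closed \<Gamma>_carrier[of 3]
    by (intro generate_subgroup_incl \<eta>.subgroup_hom_vimage sgN) (auto intro: generate.incl Y4)
  ultimately have "\<xi> ` \<Gamma> 2 \<union> \<eta> ` \<Gamma> 2 \<subseteq> ?N" using carrier_gen \<Gamma>_2 by auto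
  then have "\<Gamma> (Suc 2) \<subseteq> ?N" unfolding \<Gamma>_Suc[OF order_refl] by (rule generate_subgroup_incl[OF _ sgN])
  then have le: "card (\<Gamma> 3) \<le> card ?N"
    using finite_subset[OF subgroup.subset[OF sgN] finite_carrier]
    by (intro card_mono) (simp_all add: eval_nat_numeral)
  have "card ?N \<le> 3 * card (\<Gamma> 4)"
    using card_generate_insert2_cube[OF sg finite_\<Gamma> \<xi>.hom_closed[OF s_closed] c4[OF X[OF s_closed]]
        \<eta>.hom_closed[OF s_closed] c4[OF Y[OF s_closed]]] dep by auto
  moreover have "card (\<Gamma> 3) = 9 * card (\<Gamma> 4)"
    using card_\<Gamma>_step[of 3] indep_iff[of 3] e_ge e_le c_ge by (simp add: eval_nat_numeral)
  ultimately show False using le card_\<Gamma>_pos[of 4] by simp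
qed

lemma \<xi>_two_step_iff:
  assumes "3 \<le> j"
  shows "(\<forall>a\<in>\<Gamma> j. \<xi> a \<in> \<Gamma> (Suc (Suc j))) \<longleftrightarrow> \<sigma> (Suc j) \<in> \<Gamma> (Suc (Suc j))"
proof (intro iffI ballI)
  show "\<sigma> (Suc j) \<in> \<Gamma> (Suc (Suc j))" if "\<forall>a\<in>\<Gamma> j. \<xi> a \<in> \<Gamma> (Suc (Suc j))"
    using that \<sigma>_mem[OF assms] \<sigma>_Suc[OF assms] by simp
next
  fix a assume *: "\<sigma> (Suc j) \<in> \<Gamma> (Suc (Suc j))" "a \<in> \<Gamma> j"
  have sg: "subgroup (\<Gamma> (Suc (Suc j))) A" using assms by (intro \<Gamma>_subgroup) simp
  have "{\<sigma> j, \<tau> j} \<union> \<Gamma> (Suc j) \<subseteq> {a \<in> carrier A. \<xi> a \<in> \<Gamma> (Suc (Suc j))}"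
    using *(1) assms \<xi>_\<Gamma>[of "Suc j"] \<Gamma>_carrier[of "Suc j"] \<sigma>_closed[of j] \<tau>_closed[of j]
      \<sigma>_Suc[of j] \<xi>_\<tau>[of j] subgroup.one_closed[OF sg] by auto
  then have "\<Gamma> j \<subseteq> {a \<in> carrier A. \<xi> a \<in> \<Gamma> (Suc (Suc j))}"
    unfolding \<Gamma>_gen[OF assms] by (rule generate_subgroup_incl[OF _ \<xi>.subgroup_hom_vimage[OF sg]])
  then show "\<xi> a \<in> \<Gamma> (Suc (Suc j))" using *(2) by blast
qed

lemma \<eta>_two_step_iff:
  assumes "3 \<le> j"
  shows "(\<forall>a\<in>\<Gamma> j. \<eta> a \<in> \<Gamma> (Suc (Suc j))) \<longleftrightarrow> \<tau> (Suc j) \<in> \<Gamma> (Suc (Suc j))"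
  using two_chain_module.\<xi>_two_step_iff[OF swapped assms] .

text \<open>Criterion for \<open>\<Gamma> j\<close> to lie in the derived subgroup of a maximal subgroup generated by a diagonal
  element.\<close>

lemma subgroup_ge_\<Gamma>_4:
  assumes "subgroup N A" and "\<And>j. 4 \<le> j \<Longrightarrow> \<sigma> j \<in> N \<and> \<tau> j \<in> N" and "4 \<le> j"
  shows "\<Gamma> j \<subseteq> N"
proof (cases "j \<le> Suc c")
  case True
  then show ?thesis using assms(3)
  proof (induction j rule: inc_induct)
    case base
    show ?case using \<Gamma>_Suc_c subgroup.one_closed[OF assms(1)] by simp
  next
    case (step j)
    then show ?case
      using \<Gamma>_gen[of j] generate_subgroup_incl[OF _ assms(1), of "{\<sigma> j, \<tau> j} \<union> \<Gamma> (Suc j)"] assms(2)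
      by simp
  qed
next
  case False
  then show ?thesis using \<Gamma>_trivial[of j] subgroup.one_closed[OF assms(1)] by simp
qed

text \<open>The elements fixed by the action of \<open>x\<close> and \<open>y\<close>; they form the centre of the group.\<close>

definition fixed :: "'a set" where
  "fixed = {a \<in> carrier A. \<xi> a = \<one> \<and> \<eta> a = \<one>}"

lemma \<Gamma>_c_subset_fixed: "\<Gamma> c \<subseteq> fixed"
  using \<xi>_\<Gamma>[of c] \<eta>_\<Gamma>[of c] \<Gamma>_Suc_c \<Gamma>_carrier[of c] c_ge unfolding fixed_def by auto

lemma fixed_subset_\<Gamma>_3: "fixed \<subseteq> \<Gamma> 3"
proof
  fix a assume a: "a \<in> fixed"
  then have "a \<in> generate A (insert s (\<Gamma> 3))" using carrier_gen by (simp add: fixed_def)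
  then obtain k b where k: "k < 3" and b: "b \<in> \<Gamma> 3" and eq: "a = s [^] (k::nat) \<otimes> b"
    using generate_insert_cube[OF \<Gamma>_subgroup s_closed s_cube] by auto
  have sg: "subgroup (\<Gamma> 4) A" by (rule \<Gamma>_subgroup) simp
  have bc: "b \<in> carrier A" using b \<Gamma>_carrier[of 3] by simp
  have "\<xi> s [^] k \<otimes> \<xi> b = \<one>"
    using a eq s_closed bc by (simp add: fixed_def \<xi>.hom_nat_pow)
  then have "\<xi> s [^] k \<otimes> \<xi> b \<in> \<Gamma> 4" using subgroup.one_closed[OF sg] by simp
  moreover have "\<xi> b \<in> \<Gamma> 4" using \<xi>_\<Gamma>[of 3 b] b by (simp add: eval_nat_numeral)
  ultimately have "\<xi> s [^] k \<in> \<Gamma> 4"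
    using mult_subgroup_right_cancel[OF sg, of "\<xi> b" "\<xi> s [^] k"] s_closed by simp
  then have "k = 0"
    using \<xi>_s_\<eta>_s_independent[unfolded independent_mod_def, rule_format, of k 0] k s_closed by simp
  then show "a \<in> \<Gamma> 3" using eq b bc by simp
qed

text \<open>As long as \<open>\<sigma> (Suc j)\<close> and \<open>\<tau> (Suc j)\<close> are independent, \<open>\<xi>\<close> detects the \<open>\<sigma>\<close>-coordinate of a
  layer and \<open>\<eta>\<close> its \<open>\<tau>\<close>-coordinate, so a fixed element has both equal to zero.\<close>

lemma fixed_subset_\<Gamma>_e: "fixed \<subseteq> \<Gamma> e"
  using e_ge
proof (rule dec_induct)
  show "fixed \<subseteq> \<Gamma> 3" by (rule fixed_subset_\<Gamma>_3)
next
  fix j assume j: "3 \<le> j" "j < e" and IH: "fixed \<subseteq> \<Gamma> j"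
  show "fixed \<subseteq> \<Gamma> (Suc j)"
  proof
    fix a assume a: "a \<in> fixed"
    then obtain k l b where kl: "k < 3" "l < 3" and b: "b \<in> \<Gamma> (Suc j)"
      and eq: "a = \<sigma> j [^] (k::nat) \<otimes> (\<tau> j [^] (l::nat) \<otimes> b)"
      using \<Gamma>_decompose[OF j(1)] IH by blast
    have sg: "subgroup (\<Gamma> (Suc (Suc j))) A" using j by (intro \<Gamma>_subgroup) simp
    have bc: "b \<in> carrier A" using b \<Gamma>_carrier[of "Suc j"] j by simp
    have "\<sigma> (Suc j) [^] k \<otimes> \<xi> b = \<one>" "\<tau> (Suc j) [^] l \<otimes> \<eta> b = \<one>"
      using a \<xi>\<eta>_decomposed[OF j(1) bc, of k l] eq by (simp_all add: fixed_def)
    then have "\<sigma> (Suc j) [^] k \<otimes> \<xi> b \<in> \<Gamma> (Suc (Suc j))" "\<tau> (Suc j) [^] l \<otimes> \<eta> b \<in> \<Gamma> (Suc (Suc j))"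
      using subgroup.one_closed[OF sg] by simp_all
    moreover have "\<xi> b \<in> \<Gamma> (Suc (Suc j))" "\<eta> b \<in> \<Gamma> (Suc (Suc j))"
      using \<xi>_\<Gamma>[of "Suc j" b] \<eta>_\<Gamma>[of "Suc j" b] b j by simp_all
    ultimately have "\<sigma> (Suc j) [^] k \<in> \<Gamma> (Suc (Suc j))" "\<tau> (Suc j) [^] l \<in> \<Gamma> (Suc (Suc j))"
      using mult_subgroup_right_cancel[OF sg, of "\<xi> b" "\<sigma> (Suc j) [^] k"]
        mult_subgroup_right_cancel[OF sg, of "\<eta> b" "\<tau> (Suc j) [^] l"]
        \<sigma>_closed[of "Suc j"] \<tau>_closed[of "Suc j"] j by simp_all
    then have "k = 0" "l = 0"
      using \<sigma>_powD[of "Suc j" k] \<tau>_powD[of "Suc j" l] kl j by simp_all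
    then show "a \<in> \<Gamma> (Suc j)" using eq b bc by simp
  qed
qed


lemma image_\<eta>_\<Gamma>_4:
  assumes "a \<in> \<eta> ` carrier A" "a \<in> \<Gamma> 4"
  shows "a \<in> \<eta> ` \<Gamma> 3"
proof -
  obtain d where d: "d \<in> carrier A" "a = \<eta> d" using assms(1) by blast
  then have "d \<in> generate A (insert s (\<Gamma> 3))" using carrier_gen by simp
  then obtain k b where k: "k < 3" and b: "b \<in> \<Gamma> 3" and eq: "d = s [^] (k::nat) \<otimes> b"
    using generate_insert_cube[OF \<Gamma>_subgroup s_closed s_cube] by auto
  have sg: "subgroup (\<Gamma> 4) A" by (rule \<Gamma>_subgroup) simp
  have bc: "b \<in> carrier A" using b \<Gamma>_carrier[of 3] by simp
  have "\<eta> s [^] k \<otimes> \<eta> b \<in> \<Gamma> 4"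
    using d(2) eq s_closed bc assms(2) by (simp add: \<eta>.hom_nat_pow)
  moreover have "\<eta> b \<in> \<Gamma> 4" using \<eta>_\<Gamma>[of 3 b] b by (simp add: eval_nat_numeral)
  ultimately have "\<eta> s [^] k \<in> \<Gamma> 4"
    using mult_subgroup_right_cancel[OF sg, of "\<eta> b" "\<eta> s [^] k"] s_closed by simp
  then have "k = 0"
    using \<xi>_s_\<eta>_s_independent[unfolded independent_mod_def, rule_format, of 0 k] k s_closed by simp
  then show ?thesis using d(2) eq b bc by simp
qed

text \<open>In each layer of a preimage, the \<open>\<sigma>\<close>-coordinate is annihilated by \<open>\<eta>\<close> and can be dropped, and the
  \<open>\<tau>\<close>-coordinate reappears in the next layer of the image, where it vanishes because \<open>a\<close> lies deeper.
  Thus the layer can be stripped off, as long as the next one has order 9.\<close>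

lemma image_\<eta>_\<Gamma>:
  assumes a: "a \<in> \<eta> ` carrier A" "a \<in> \<Gamma> c" and j: "3 \<le> j" "j \<le> e" "j < c"
  shows "a \<in> \<eta> ` \<Gamma> j"
  using j
proof (induction j rule: dec_induct)
  case base
  have "a \<in> \<Gamma> 4" using \<Gamma>_antimono[of 4 c] c_ge a(2) by auto
  then show ?case by (rule image_\<eta>_\<Gamma>_4[OF a(1)])
next
  case (step j)
  have "a \<in> \<Gamma> (Suc (Suc j))" using \<Gamma>_antimono[of "Suc (Suc j)" c] step.prems a(2) by auto
  moreover have "a \<in> \<eta> ` \<Gamma> j" using step by simp
  ultimately obtain l b where l: "l < 3" and b: "b \<in> \<Gamma> (Suc j)"
    and mem: "\<tau> (Suc j) [^] (l::nat) \<in> \<Gamma> (Suc (Suc j))" and eq: "a = \<tau> (Suc j) [^] l \<otimes> \<eta> b"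
    using image_\<eta>_descend[OF step.hyps(1)] by metis
  have "l = 0" using \<tau>_powD[OF _ _ mem l] step by simp
  then have "a = \<eta> b" using eq b \<Gamma>_carrier[of "Suc j" b] step.hyps by simp
  then show ?case using b by blast
qed

text \<open>If the last layer is two-dimensional, a preimage can be taken in the layer before it, where \<open>\<eta>\<close>
  yields only powers of \<open>\<tau> c\<close>, and these are independent of \<open>\<sigma> c\<close>.\<close>

lemma \<sigma>_c_notin_image_\<eta>_bicyclic:
  assumes e: "e = c"
  shows "\<sigma> c \<notin> \<eta> ` carrier A"
proof
  assume *: "\<sigma> c \<in> \<eta> ` carrier A"
  have \<sigma>: "\<sigma> c \<in> \<Gamma> c" by (rule \<sigma>_mem) (use c_ge in simp)
  have sg: "subgroup (\<Gamma> (Suc c)) A" by (rule \<Gamma>_subgroup) (use c_ge in simp)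
  have c: "3 \<le> c" using c_ge by simp
  define j where "j = c - 1"
  have j: "3 \<le> j" "j \<le> e" "j < c" "Suc j = c" using c_ge e by (simp_all add: j_def)
  have "\<sigma> c \<in> \<eta> ` \<Gamma> j" by (rule image_\<eta>_\<Gamma>[OF * \<sigma> j(1-3)])
  then obtain d where d: "d \<in> \<Gamma> j" "\<sigma> c = \<eta> d" by blast
  obtain k l b where b: "b \<in> \<Gamma> c"
    and eq: "d = \<sigma> j [^] (k::nat) \<otimes> (\<tau> j [^] (l::nat) \<otimes> b)"
    using \<Gamma>_decompose[OF j(1) d(1)] unfolding j(4) by metis
  have bc: "b \<in> carrier A" using b \<Gamma>_carrier[of c] c_ge by simp
  have "\<eta> b = \<one>" using \<eta>_\<Gamma>[OF _ b] \<Gamma>_Suc_c c_ge by simp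
  then have "\<sigma> c = \<tau> c [^] l"
    using d(2) \<xi>\<eta>_decomposed(2)[OF j(1) bc, of k l] eq j(4) \<tau>_closed[of c] c_ge by simp
  moreover have "subgroup (generate A (insert (\<tau> c) (\<Gamma> (Suc c)))) A"
    using \<tau>_closed[OF c] subgroup.subset[OF sg] by (intro generate_is_subgroup) simp
  ultimately have "\<sigma> c \<in> generate A (insert (\<tau> c) (\<Gamma> (Suc c)))"
    using subgroup_nat_pow[of _ "\<tau> c" l] by (simp add: generate.incl)
  then show False
    using independent_mod_iff[OF sg \<sigma>_closed[OF c] \<sigma>_cube[OF c] \<tau>_closed[OF c] \<tau>_cube[OF c]]
      indep_iff[OF c] e by simp
qed

lemma \<tau>_c_notin_image_\<xi>_bicyclic: "e = c \<Longrightarrow> \<tau> c \<notin> \<xi> ` carrier A"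
  using two_chain_module.\<sigma>_c_notin_image_\<eta>_bicyclic[OF swapped] .

end

section \<open>The effect of selecting the generators by two-step centralizers\<close>

text \<open>With \<open>r\<close> the first index whose two-step centralizer is larger than the commutator subgroup,
  membership of an element of \<open>G\<close> in the two-step centralizer of index \<open>j\<close> says that its action
  maps \<open>\<Gamma> j\<close> into \<open>\<Gamma> (Suc (Suc j))\<close>.  This breaks the symmetry between the two chains.\<close>

locale selected_two_chain_module = two_chain_module +
  fixes r :: nat
  assumes r_ge: "2 \<le> r" and r_le: "r \<le> c"
    and selected_\<eta>: "a \<in> \<Gamma> r \<Longrightarrow> \<eta> a \<in> \<Gamma> (Suc (Suc r))"
    and selected_\<xi>: "r < c \<Longrightarrow> \<exists>a\<in>\<Gamma> r. \<xi> a \<notin> \<Gamma> (Suc (Suc r))"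
    and minimal_\<xi>: "2 \<le> j \<Longrightarrow> j < r \<Longrightarrow> \<exists>a\<in>\<Gamma> j. \<xi> a \<notin> \<Gamma> (Suc (Suc j))"
    and minimal_\<eta>: "2 \<le> j \<Longrightarrow> j < r \<Longrightarrow> \<exists>a\<in>\<Gamma> j. \<eta> a \<notin> \<Gamma> (Suc (Suc j))"
begin

lemma e_le_r: "e \<le> r"
proof (rule ccontr)
  assume "\<not> e \<le> r"
  show False
  proof (cases "r = 2")
    case True
    have "\<eta> s \<in> \<Gamma> (Suc (Suc 2))" using selected_\<eta>[of s] True \<Gamma>_2 s_closed by simp
    then have "\<eta> s \<in> \<Gamma> 4" by (simp add: eval_nat_numeral)
    then show False
      using \<xi>_s_\<eta>_s_independent[unfolded independent_mod_def, rule_format, of 0 1] s_closed by simp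
  next
    case False
    then have r: "3 \<le> r" using r_ge by simp
    have "\<tau> (Suc r) [^] (1::nat) \<in> \<Gamma> (Suc (Suc r))"
      using \<eta>_two_step_iff[OF r] selected_\<eta> \<tau>_closed[of "Suc r"] r by simp
    then show False using \<tau>_powD[of "Suc r" 1] r \<open>\<not> e \<le> r\<close> by simp
  qed
qed

text \<open>In the first layer of order 3, \<open>\<sigma>\<close> survives, while \<open>\<tau>\<close> vanishes unless this is the last layer of
  all.  If \<open>r = e\<close> this is what the selection of the generators says.  If \<open>r > e\<close>, both survive, and
  a dependence between them involves both; it is passed on to the next layer as the vanishing of
  either chain there, so there is no next layer.\<close>

lemma uniserial_start:
  assumes "e < c"
  shows "\<sigma> (Suc e) \<notin> \<Gamma> (Suc (Suc e))" and "\<tau> (Suc e) \<in> \<Gamma> (Suc (Suc e)) \<or> c = Suc e"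
proof -
  have "\<sigma> (Suc e) \<notin> \<Gamma> (Suc (Suc e)) \<and> (\<tau> (Suc e) \<in> \<Gamma> (Suc (Suc e)) \<or> c = Suc e)"
  proof (cases "r = e")
    case True
    then show ?thesis
      using \<xi>_two_step_iff[OF e_ge] \<eta>_two_step_iff[OF e_ge] selected_\<xi> selected_\<eta> assms by auto
  next
    case False
    then have "e < r" using e_le_r by simp
    then have \<sigma>: "\<sigma> (Suc e) \<notin> \<Gamma> (Suc (Suc e))" and \<tau>: "\<tau> (Suc e) \<notin> \<Gamma> (Suc (Suc e))"
      using \<xi>_two_step_iff[OF e_ge] \<eta>_two_step_iff[OF e_ge] minimal_\<xi>[of e] minimal_\<eta>[of e] e_ge
      by auto
    let ?E = "Suc e" let ?F = "Suc (Suc e)" let ?H = "Suc (Suc (Suc e))"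
    have 3: "3 \<le> ?E" "3 \<le> ?F" using e_ge by simp_all
    have sg: "subgroup (\<Gamma> ?F) A" "subgroup (\<Gamma> ?H) A" using e_ge by (intro \<Gamma>_subgroup; simp)+
    have "\<not> indep ?E" using indep_iff[of ?E] assms e_ge by simp
    then obtain k l :: nat where kl: "k < 3" "l < 3" "\<not> (k = 0 \<and> l = 0)"
      and mem: "\<sigma> ?E [^] k \<otimes> \<tau> ?E [^] l \<in> \<Gamma> ?F"
      unfolding independent_mod_def by metis
    note cl = \<sigma>_closed[OF 3(1)] \<tau>_closed[OF 3(1)] \<sigma>_closed[OF 3(2)] \<tau>_closed[OF 3(2)]
    have k: "0 < k"
    proof (rule ccontr)
      assume "\<not> 0 < k"
      then have "\<tau> ?E [^] l \<in> \<Gamma> ?F" "0 < l" using mem kl cl by simp_all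
      then show False using mem_if_nat_pow_mem[OF sg(1) cl(2) \<tau>_cube[OF 3(1)]] kl(2) \<tau> by blast
    qed
    have l: "0 < l"
    proof (rule ccontr)
      assume "\<not> 0 < l"
      then have "\<sigma> ?E [^] k \<in> \<Gamma> ?F" using mem cl by simp
      then show False using mem_if_nat_pow_mem[OF sg(1) cl(1) \<sigma>_cube[OF 3(1)]] kl(1) k \<sigma> by blast
    qed
    have eq: "\<sigma> ?E [^] k \<otimes> (\<tau> ?E [^] l \<otimes> \<one>) = \<sigma> ?E [^] k \<otimes> \<tau> ?E [^] l"
      using cl by simp
    have "\<sigma> ?F [^] k \<in> \<Gamma> ?H" "\<tau> ?F [^] l \<in> \<Gamma> ?H"
      using \<xi>_\<Gamma>[OF _ mem] \<eta>_\<Gamma>[OF _ mem] \<xi>\<eta>_decomposed[OF 3(1) one_closed, of k l] cl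
      unfolding eq by simp_all
    then have "\<sigma> ?F \<in> \<Gamma> ?H" "\<tau> ?F \<in> \<Gamma> ?H"
      using mem_if_nat_pow_mem[OF sg(2) cl(3) \<sigma>_cube[OF 3(2)]] mem_if_nat_pow_mem[OF sg(2) cl(4) \<tau>_cube[OF 3(2)]]
        k l kl by simp_all
    then have "\<Gamma> ?F \<subseteq> \<Gamma> ?H"
      using \<Gamma>_gen[OF 3(2)] generate_subgroup_incl[OF _ sg(2), of "{\<sigma> ?F, \<tau> ?F} \<union> \<Gamma> ?H"] by simp
    then have "\<Gamma> ?H = \<Gamma> ?F" using \<Gamma>_decreasing[of ?F] e_ge by auto
    then have "\<not> ?F \<le> c" using \<Gamma>_strict[of ?F] e_ge by auto
    then show ?thesis using \<sigma> assms by simp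
  qed
  then show "\<sigma> (Suc e) \<notin> \<Gamma> (Suc (Suc e))" and "\<tau> (Suc e) \<in> \<Gamma> (Suc (Suc e)) \<or> c = Suc e"
    by auto
qed

lemma \<sigma>_notin:
  assumes "e < j" "j \<le> c"
  shows "\<sigma> j \<notin> \<Gamma> (Suc j)"
proof (cases "c = Suc e")
  case True
  then show ?thesis using uniserial_start(1) assms by (simp add: le_Suc_eq)
next
  case False
  have \<tau>: "\<tau> j \<in> \<Gamma> (Suc j)"
    using Suc_leI[OF assms(1)]
  proof (induction rule: dec_induct)
    case base
    show ?case using uniserial_start(2) False assms by simp
  next
    case (step i)
    then show ?case using \<eta>_\<Gamma>[of "Suc i" "\<tau> i"] \<tau>_Suc[of i] e_ge by simp
  qed
  have j: "3 \<le> j" using assms e_ge by simp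
  show ?thesis
  proof
    assume "\<sigma> j \<in> \<Gamma> (Suc j)"
    moreover have "subgroup (\<Gamma> (Suc j)) A" using j by (intro \<Gamma>_subgroup) simp
    ultimately have "\<Gamma> j \<subseteq> \<Gamma> (Suc j)"
      using \<tau> \<Gamma>_gen[OF j] generate_subgroup_incl[of "{\<sigma> j, \<tau> j} \<union> \<Gamma> (Suc j)" "\<Gamma> (Suc j)"] by simp
    then show False using \<Gamma>_strict[of j] \<Gamma>_decreasing[of j] j assms by auto
  qed
qed

text \<open>Beyond \<open>e\<close> the layers have order 3, and \<open>\<sigma> j\<close> is non-trivial in its layer.\<close>

lemma \<Gamma>_uniserial:
  assumes "e < j" "j \<le> c"
  shows "\<Gamma> j = generate A (insert (\<sigma> j) (\<Gamma> (Suc j)))"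
proof -
  have j: "3 \<le> j" using assms e_ge by simp
  have sg: "subgroup (\<Gamma> (Suc j)) A" using j by (intro \<Gamma>_subgroup) simp
  have "card (\<Gamma> j) = 3 * card (\<Gamma> (Suc j))"
    using card_\<Gamma>_step[OF j assms(2)] indep_iff[OF j assms(2)] assms(1) by simp
  moreover have "card (generate A (insert (\<sigma> j) (\<Gamma> (Suc j)))) = 3 * card (\<Gamma> (Suc j))"
    using card_generate_insert_cube[OF sg finite_\<Gamma> \<sigma>_closed[OF j] \<sigma>_cube[OF j] \<sigma>_notin[OF assms]] j
    by simp
  moreover have "generate A (insert (\<sigma> j) (\<Gamma> (Suc j))) \<subseteq> \<Gamma> j"
    using \<sigma>_mem[OF j] \<Gamma>_decreasing[of j] j by (intro generate_subgroup_incl \<Gamma>_subgroup) auto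
  moreover have "finite (\<Gamma> j)" using finite_\<Gamma> j by simp
  ultimately show ?thesis using card_subset_eq by metis
qed

lemma \<Gamma>_uniserial_decompose:
  assumes "e < j" "j \<le> c" "a \<in> \<Gamma> j"
  obtains k b where "k < 3" "b \<in> \<Gamma> (Suc j)" "a = \<sigma> j [^] (k::nat) \<otimes> b"
proof -
  have j: "3 \<le> j" using assms e_ge by simp
  have sg: "subgroup (\<Gamma> (Suc j)) A" using j by (intro \<Gamma>_subgroup) simp
  show ?thesis
    using generate_insert_cube[OF sg \<sigma>_closed[OF j] \<sigma>_cube[OF j]] \<Gamma>_uniserial[OF assms(1,2)]
      assms(3) that by auto
qed

text \<open>On the uniserial part, \<open>\<xi>\<close> maps each layer isomorphically onto the next, so that its kernel is the
  last layer.\<close>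

lemma ker_\<xi>_uniserial:
  assumes "e < j" "j \<le> c" "a \<in> \<Gamma> j" "\<xi> a = \<one>"
  shows "a \<in> \<Gamma> c"
  using assms(2)
proof (rule dec_induct)
  show "a \<in> \<Gamma> j" by (rule assms(3))
next
  fix i assume i: "j \<le> i" "i < c" and IH: "a \<in> \<Gamma> i"
  have ei: "e < i" "3 \<le> i" "i \<le> c" using i assms(1) e_ge by simp_all
  obtain k b where k: "k < 3" and b: "b \<in> \<Gamma> (Suc i)" and eq: "a = \<sigma> i [^] (k::nat) \<otimes> b"
    using \<Gamma>_uniserial_decompose[OF ei(1,3) IH] by metis
  have sg: "subgroup (\<Gamma> (Suc (Suc i))) A" using ei by (intro \<Gamma>_subgroup) simp
  have bc: "b \<in> carrier A" using b \<Gamma>_carrier[of "Suc i"] ei by simp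
  have cl: "\<sigma> (Suc i) \<in> carrier A" using \<sigma>_closed[of "Suc i"] ei by simp
  have "\<sigma> (Suc i) [^] k \<otimes> \<xi> b = \<one>"
    using \<xi>\<eta>_decomposed(1)[OF ei(2) bc, of k 0] bc assms(4) eq \<tau>_closed[OF ei(2)] by simp
  then have "\<sigma> (Suc i) [^] k \<otimes> \<xi> b \<in> \<Gamma> (Suc (Suc i))" using subgroup.one_closed[OF sg] by simp
  moreover have "\<xi> b \<in> \<Gamma> (Suc (Suc i))" using \<xi>_\<Gamma>[of "Suc i" b] b ei by simp
  ultimately have mem: "\<sigma> (Suc i) [^] k \<in> \<Gamma> (Suc (Suc i))"
    using mult_subgroup_right_cancel[OF sg, of "\<xi> b" "\<sigma> (Suc i) [^] k"] cl by simp
  have "k = 0"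
  proof (rule ccontr)
    assume "k \<noteq> 0"
    then have "\<sigma> (Suc i) \<in> \<Gamma> (Suc (Suc i))"
      using mem_if_nat_pow_mem[OF sg cl \<sigma>_cube[of "Suc i"] mem] k ei by simp
    then show False using \<sigma>_notin[of "Suc i"] i ei by simp
  qed
  then show "a \<in> \<Gamma> (Suc i)" using eq b bc by simp
qed

text \<open>The decisive consequence: since \<open>\<xi>\<close> annihilates the \<open>\<tau>\<close>-chain, \<open>\<tau> (Suc e)\<close> is either trivial or a
  generator of the last term \<open>\<Gamma> c\<close> of order 3.  This is the dichotomy between the unipolar and the
  nilpolar case.\<close>

lemma \<tau>_Suc_e_mem: "e < c \<Longrightarrow> \<tau> (Suc e) \<in> \<Gamma> c"
  using ker_\<xi>_uniserial[of "Suc e" "\<tau> (Suc e)"] \<tau>_mem[of "Suc e"] \<xi>_\<tau>[of "Suc e"] e_ge by simp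

lemma \<Gamma>_c_cyclic: "e < c \<Longrightarrow> \<Gamma> c = generate A {\<sigma> c}"
  using \<Gamma>_uniserial[of c] \<Gamma>_Suc_c generate_insert_one[of "\<sigma> c"] \<sigma>_closed[of c] c_ge by simp

lemma card_\<Gamma>_c: "card (\<Gamma> c) = (if e < c then 3 else 9)"
  using card_\<Gamma>_step[of c] indep_iff[of c] c_ge e_le \<Gamma>_Suc_c by auto

lemma \<eta>_\<Gamma>_Suc_e:
  assumes "e < j" "a \<in> \<Gamma> j"
  shows "\<eta> a = \<one>"
proof (cases "j \<le> Suc c")
  case True
  then show ?thesis using assms
  proof (induction j arbitrary: a rule: inc_induct)
    case base
    then show ?case using \<Gamma>_Suc_c by simp
  next
    case (step j)
    obtain k b where b: "b \<in> \<Gamma> (Suc j)" and eq: "a = \<sigma> j [^] (k::nat) \<otimes> b"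
      using \<Gamma>_uniserial_decompose[of j a] step by (metis less_Suc_eq_le)
    have j: "3 \<le> j" using step e_ge by simp
    have "b \<in> carrier A" using b \<Gamma>_carrier[of "Suc j"] j by simp
    moreover have "\<eta> b = \<one>" using step.IH[OF _ b] step.prems by simp
    ultimately show ?case
      using eq \<eta>_\<sigma>[OF j] \<sigma>_closed[OF j] by (simp add: \<eta>.hom_nat_pow)
  qed
next
  case False
  then show ?thesis using assms \<Gamma>_trivial[of j] by simp
qed


lemma \<sigma>_c_ne_one: "\<sigma> c \<noteq> \<one>"
proof (cases "e < c")
  case True
  then show ?thesis using \<sigma>_notin[of c] \<Gamma>_Suc_c by simp
next
  case False
  then show ?thesis using \<sigma>_powD[of c 1] \<sigma>_closed[of c] e_le c_ge \<Gamma>_Suc_c by auto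
qed

lemma \<Gamma>_c_bicyclic: "e = c \<Longrightarrow> \<Gamma> c = generate A {\<sigma> c, \<tau> c}"
proof -
  have "generate A {\<sigma> c, \<tau> c, \<one>} = generate A {\<sigma> c, \<tau> c}"
    using \<sigma>_closed[of c] \<tau>_closed[of c] c_ge
    by (intro equalityI mono_generate generate_subgroup_incl generate_is_subgroup)
      (auto intro: generate.incl generate.one)
  then show ?thesis using \<Gamma>_gen[of c] c_ge \<Gamma>_Suc_c by (simp add: insert_commute)
qed

text \<open>For \<open>e < c\<close>, \<open>\<tau> e\<close> is non-trivial in the layer \<open>e\<close>, while \<open>\<sigma> c\<close> lies deeper; for \<open>e = c\<close> both are
  independent.  This separates the right-hand sides of the three equivalences from each other.\<close>

lemma \<tau>_e_notin: "\<tau> e \<notin> generate A {\<sigma> c}"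
proof (cases "e < c")
  case True
  have "\<tau> e \<notin> \<Gamma> (Suc e)"
    using \<tau>_powD[of e 1] \<tau>_closed[of e] e_ge by auto
  then show ?thesis
    using \<Gamma>_antimono[of "Suc e" c] True \<Gamma>_c_cyclic[OF True] e_ge by auto
next
  case False
  then have e: "e = c" using e_le by simp
  have c: "3 \<le> c" using c_ge by simp
  have sg: "subgroup (\<Gamma> (Suc c)) A" by (rule \<Gamma>_subgroup) (use c_ge in simp)
  have "independent_mod (\<Gamma> (Suc c)) (\<tau> c) (\<sigma> c)"
    using indep_iff[of c] e c independent_mod_sym[OF \<sigma>_closed[OF c] \<tau>_closed[OF c]] by simp
  then have "\<tau> c \<notin> generate A (insert (\<sigma> c) (\<Gamma> (Suc c)))"
    using independent_mod_iff[OF sg \<tau>_closed[OF c] \<tau>_cube[OF c] \<sigma>_closed[OF c] \<sigma>_cube[OF c]] by simp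
  then show ?thesis using e \<Gamma>_Suc_c generate_insert_one[of "\<sigma> c"] \<sigma>_closed[OF c] by simp
qed

text \<open>For \<open>e < c\<close>, a preimage of \<open>\<sigma> c\<close> could be taken in \<open>\<Gamma> e\<close>, where \<open>\<eta>\<close> takes only powers of
  \<open>\<tau> (Suc e)\<close> as values.\<close>

lemma \<sigma>_c_notin_image_\<eta>:
  assumes \<tau>: "\<tau> (Suc e) = \<one>"
  shows "\<sigma> c \<notin> \<eta> ` carrier A"
proof
  assume *: "\<sigma> c \<in> \<eta> ` carrier A"
  have \<sigma>: "\<sigma> c \<in> \<Gamma> c" by (rule \<sigma>_mem) (use c_ge in simp)
  show False
  proof (cases "e < c")
    case True
    have "\<sigma> c \<in> \<eta> ` \<Gamma> e" by (rule image_\<eta>_\<Gamma>[OF * \<sigma> e_ge order_refl True])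
    then obtain d where d: "d \<in> \<Gamma> e" "\<sigma> c = \<eta> d" by blast
    obtain k l b where b: "b \<in> \<Gamma> (Suc e)"
      and eq: "d = \<sigma> e [^] (k::nat) \<otimes> (\<tau> e [^] (l::nat) \<otimes> b)"
      using \<Gamma>_decompose[OF e_ge d(1)] by metis
    have bc: "b \<in> carrier A" using b \<Gamma>_carrier[of "Suc e"] e_ge by simp
    have "\<sigma> c = \<one>"
      using d(2) \<xi>\<eta>_decomposed(2)[OF e_ge bc, of k l] eq \<tau> \<eta>_\<Gamma>_Suc_e[OF lessI b] by simp
    then show False using \<sigma>_c_ne_one by simp
  next
    case False
    then show False using \<sigma>_c_notin_image_\<eta>_bicyclic * e_le by simp
  qed
qed

text \<open>For \<open>e < c\<close>, a fixed element of \<open>\<Gamma> e\<close> has \<open>\<sigma>\<close>-coordinate zero in the layer \<open>e\<close>, by \<open>\<xi>\<close>; the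
  uniserial rest lies in \<open>\<Gamma> c\<close>.  The remaining power of \<open>\<tau> e\<close> is annihilated by \<open>\<eta>\<close> only if it is trivial or
  \<open>\<tau> (Suc e) = \<one>\<close>.\<close>

lemma fixed_cases:
  "fixed = (if e < c \<and> \<tau> (Suc e) = \<one> then generate A {\<sigma> c, \<tau> e} else \<Gamma> c)"
proof (cases "e < c")
  case False
  then show ?thesis using fixed_subset_\<Gamma>_e \<Gamma>_c_subset_fixed e_le by auto
next
  case True
  have c: "3 \<le> c" using c_ge by simp
  have dec: "\<exists>l b. l < 3 \<and> b \<in> \<Gamma> c \<and> a = \<tau> e [^] (l::nat) \<otimes> b \<and> \<tau> (Suc e) [^] l = \<one>"
    if a: "a \<in> fixed" for a
  proof -
    obtain k l b where kl: "k < 3" "l < 3" and b: "b \<in> \<Gamma> (Suc e)"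
      and eq: "a = \<sigma> e [^] (k::nat) \<otimes> (\<tau> e [^] (l::nat) \<otimes> b)"
      using \<Gamma>_decompose[OF e_ge] fixed_subset_\<Gamma>_e a by blast
    have bc: "b \<in> carrier A" using b \<Gamma>_carrier[of "Suc e"] e_ge by simp
    have cl: "\<sigma> (Suc e) \<in> carrier A" "\<tau> (Suc e) \<in> carrier A"
      using \<sigma>_closed[of "Suc e"] \<tau>_closed[of "Suc e"] e_ge by simp_all
    have sg: "subgroup (\<Gamma> (Suc (Suc e))) A" using e_ge by (intro \<Gamma>_subgroup) simp
    have X: "\<sigma> (Suc e) [^] k \<otimes> \<xi> b = \<one>" and Y: "\<tau> (Suc e) [^] l \<otimes> \<eta> b = \<one>"
      using a \<xi>\<eta>_decomposed[OF e_ge bc, of k l] eq by (simp_all add: fixed_def)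
    have "\<xi> b \<in> \<Gamma> (Suc (Suc e))" using \<xi>_\<Gamma>[of "Suc e" b] b e_ge by simp
    then have mem: "\<sigma> (Suc e) [^] k \<in> \<Gamma> (Suc (Suc e))"
      using mult_subgroup_right_cancel[OF sg, of "\<xi> b" "\<sigma> (Suc e) [^] k"] cl X
        subgroup.one_closed[OF sg] by simp
    have k: "k = 0"
    proof (rule ccontr)
      assume "k \<noteq> 0"
      then have "\<sigma> (Suc e) \<in> \<Gamma> (Suc (Suc e))"
        using mem_if_nat_pow_mem[OF sg cl(1) \<sigma>_cube[of "Suc e"] mem] kl e_ge by simp
      then show False using uniserial_start(1)[OF True] by simp
    qed
    then have "\<xi> b = \<one>" using X bc by simp
    then have "b \<in> \<Gamma> c" using ker_\<xi>_uniserial[OF lessI _ b] True by simp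
    moreover have "\<tau> (Suc e) [^] l = \<one>" using Y \<eta>_\<Gamma>_Suc_e[OF lessI b] cl by simp
    moreover have "a = \<tau> e [^] l \<otimes> b" using eq k bc \<tau>_closed[OF e_ge] by simp
    ultimately show ?thesis using kl by blast
  qed
  show ?thesis
  proof (cases "\<tau> (Suc e) = \<one>")
    case \<tau>: True
    let ?B = "generate A {\<sigma> c, \<tau> e}"
    have cl: "{\<sigma> c, \<tau> e} \<subseteq> carrier A" using \<sigma>_closed[OF c] \<tau>_closed[OF e_ge] by simp
    have sg: "subgroup ?B A" by (rule generate_is_subgroup[OF cl])
    have \<Gamma>B: "\<Gamma> c \<subseteq> ?B" unfolding \<Gamma>_c_cyclic[OF True] by (rule mono_generate) simp
    have "fixed \<subseteq> ?B"
    proof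
      fix a assume "a \<in> fixed"
      then obtain l b where "b \<in> \<Gamma> c" and a: "a = \<tau> e [^] (l::nat) \<otimes> b" using dec by blast
      moreover have "\<tau> e [^] l \<in> ?B" by (intro subgroup_nat_pow[OF sg] generate.incl) simp
      ultimately show "a \<in> ?B" using subgroup.m_closed[OF sg] \<Gamma>B by blast
    qed
    moreover have "?B \<subseteq> fixed"
    proof -
      have "subgroup ({a \<in> carrier A. \<xi> a \<in> {\<one>}} \<inter> {a \<in> carrier A. \<eta> a \<in> {\<one>}}) A"
        by (intro subgroups_Inter_pair \<xi>.subgroup_hom_vimage \<eta>.subgroup_hom_vimage triv_subgroup)
      moreover have "{a \<in> carrier A. \<xi> a \<in> {\<one>}} \<inter> {a \<in> carrier A. \<eta> a \<in> {\<one>}} = fixed"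
        unfolding fixed_def by auto
      moreover have "\<sigma> c \<in> fixed" using \<Gamma>_c_subset_fixed \<sigma>_mem[OF c] by blast
      moreover have "\<tau> e \<in> fixed"
        using \<tau> \<tau>_Suc[OF e_ge] \<xi>_\<tau>[OF e_ge] \<tau>_closed[OF e_ge] by (simp add: fixed_def)
      ultimately show ?thesis using generate_subgroup_incl[of "{\<sigma> c, \<tau> e}" fixed] by simp
    qed
    ultimately show ?thesis using True \<tau> by simp
  next
    case \<tau>: False
    have "fixed \<subseteq> \<Gamma> c"
    proof
      fix a assume "a \<in> fixed"
      then obtain l b where l: "l < 3" "\<tau> (Suc e) [^] (l::nat) = \<one>" and b: "b \<in> \<Gamma> c"
        and a: "a = \<tau> e [^] l \<otimes> b" using dec by blast
      have cl: "\<tau> (Suc e) \<in> carrier A" using \<tau>_closed[of "Suc e"] e_ge by simp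
      have "\<tau> (Suc e) [^] (3::nat) = \<one>"
        using cube_mem_\<Gamma>[OF _ \<tau>_Suc_e_mem[OF True]] \<Gamma>_Suc_c c by simp
      then have "l = 0"
        using mem_if_nat_pow_mem[OF triv_subgroup cl, of l] l \<tau> by (cases "l = 0") simp_all
      then show "a \<in> \<Gamma> c" using a b \<Gamma>_carrier[of c b] c by simp
    qed
    then show ?thesis using \<Gamma>_c_subset_fixed \<tau> by auto
  qed
qed

lemma \<Gamma>_c_gen_\<tau>:
  assumes "e < c" "\<tau> (Suc e) \<noteq> \<one>"
  shows "generate A {\<tau> (Suc e)} = \<Gamma> c"
proof -
  have c: "3 \<le> c" using c_ge by simp
  have sg: "subgroup (\<Gamma> c) A" by (rule \<Gamma>_subgroup) (use c in simp)
  have cl: "\<tau> (Suc e) \<in> carrier A" using \<tau>_closed[of "Suc e"] e_ge by simp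
  have "\<tau> (Suc e) [^] (3::nat) = \<one>"
    using cube_mem_\<Gamma>[OF _ \<tau>_Suc_e_mem[OF assms(1)]] \<Gamma>_Suc_c c by simp
  then have "card (generate A {\<tau> (Suc e)}) = 3"
    using card_generate_insert_cube[OF triv_subgroup _ cl] assms(2) generate_insert_one[OF cl] by simp
  moreover have "generate A {\<tau> (Suc e)} \<subseteq> \<Gamma> c"
    using generate_subgroup_incl[OF _ sg] \<tau>_Suc_e_mem[OF assms(1)] by simp
  moreover have "finite (\<Gamma> c)" by (rule finite_\<Gamma>) (use c in simp)
  moreover have "card (\<Gamma> c) = 3" using card_\<Gamma>_c assms by simp
  ultimately show ?thesis using card_subset_eq by metis
qed

lemma \<Gamma>_c_image_\<xi>_iff: "\<Gamma> c \<subseteq> \<xi> ` carrier A \<longleftrightarrow> e < c"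
proof
  assume "e < c"
  have sg: "subgroup (\<xi> ` carrier A) A" by (rule \<xi>.img_is_subgroup)
  define j where "j = c - 1"
  have j: "3 \<le> j" "Suc j = c" using c_ge by (simp_all add: j_def)
  have "\<sigma> c \<in> \<xi> ` carrier A" using \<sigma>_Suc[OF j(1)] \<sigma>_closed[OF j(1)] j(2) by auto
  then show "\<Gamma> c \<subseteq> \<xi> ` carrier A"
    unfolding \<Gamma>_c_cyclic[OF \<open>e < c\<close>] by (intro generate_subgroup_incl sg) simp
next
  assume *: "\<Gamma> c \<subseteq> \<xi> ` carrier A"
  show "e < c"
  proof (rule ccontr)
    assume "\<not> e < c"
    then have e: "e = c" using e_le by simp
    have "\<tau> c \<in> \<xi> ` carrier A" using * \<tau>_mem[of c] c_ge by auto
    then show False using \<tau>_c_notin_image_\<xi>_bicyclic[OF e] by simp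
  qed
qed

lemma \<Gamma>_c_image_\<eta>_iff: "\<Gamma> c \<subseteq> \<eta> ` carrier A \<longleftrightarrow> e < c \<and> \<tau> (Suc e) \<noteq> \<one>"
proof
  assume *: "\<Gamma> c \<subseteq> \<eta> ` carrier A"
  then have \<tau>: "\<tau> (Suc e) \<noteq> \<one>" using \<sigma>_c_notin_image_\<eta> \<sigma>_mem[of c] c_ge by auto
  moreover have "\<tau> (Suc e) \<in> \<Gamma> (Suc e)" using \<tau>_mem[of "Suc e"] e_ge by simp
  ultimately have "\<Gamma> (Suc e) \<noteq> {\<one>}" by blast
  then have "e < c" using \<Gamma>_trivial[of "Suc e"] e_le by linarith
  with \<tau> show "e < c \<and> \<tau> (Suc e) \<noteq> \<one>" by simp
next
  assume *: "e < c \<and> \<tau> (Suc e) \<noteq> \<one>"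
  have sg: "subgroup (\<eta> ` carrier A) A" by (rule \<eta>.img_is_subgroup)
  have "\<tau> (Suc e) \<in> \<eta> ` carrier A" using \<tau>_Suc[OF e_ge] \<tau>_closed[OF e_ge] by auto
  then show "\<Gamma> c \<subseteq> \<eta> ` carrier A"
    using \<Gamma>_c_gen_\<tau> * generate_subgroup_incl[OF _ sg, of "{\<tau> (Suc e)}"] by simp
qed

end

section \<open>Commutator calculus and the lower central series\<close>

context group
begin

lemma inv_mult_cancel: "a \<in> carrier G \<Longrightarrow> b \<in> carrier G \<Longrightarrow> inv a \<otimes> (a \<otimes> b) = b"
  and mult_inv_cancel: "a \<in> carrier G \<Longrightarrow> b \<in> carrier G \<Longrightarrow> a \<otimes> (inv a \<otimes> b) = b"
  by (simp_all flip: m_assoc)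

abbreviation conj_by :: "'a \<Rightarrow> 'a \<Rightarrow> 'a" where
  "conj_by g a \<equiv> inv g \<otimes> a \<otimes> g"

lemmas word_simps = commutator_def m_assoc inv_mult_group inv_mult_cancel mult_inv_cancel

lemma commutator_closed [simp]: "a \<in> carrier G \<Longrightarrow> b \<in> carrier G \<Longrightarrow> commutator G a b \<in> carrier G"
  by (simp add: commutator_def)

lemma commutator_one:
  assumes "a \<in> carrier G"
  shows "commutator G a \<one> = \<one>" "commutator G \<one> a = \<one>" "commutator G a a = \<one>"
  using assms by (simp_all add: word_simps)

lemma inv_commutator:
  "a \<in> carrier G \<Longrightarrow> b \<in> carrier G \<Longrightarrow> inv (commutator G a b) = commutator G b a"
  by (simp add: word_simps)

lemma commutator_mult_left:
  "a \<in> carrier G \<Longrightarrow> b \<in> carrier G \<Longrightarrow> g \<in> carrier G \<Longrightarrow>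
    commutator G (a \<otimes> b) g = conj_by b (commutator G a g) \<otimes> commutator G b g"
  by (simp add: word_simps)

lemma commutator_mult_right:
  "a \<in> carrier G \<Longrightarrow> g \<in> carrier G \<Longrightarrow> h \<in> carrier G \<Longrightarrow>
    commutator G a (g \<otimes> h) = commutator G a h \<otimes> conj_by h (commutator G a g)"
  by (simp add: word_simps)

lemma commutator_inv_left:
  "a \<in> carrier G \<Longrightarrow> g \<in> carrier G \<Longrightarrow>
    commutator G (inv g) a = inv (conj_by (inv g) (commutator G g a))"
  by (simp add: word_simps)

lemma conj_by_eq: "a \<in> carrier G \<Longrightarrow> g \<in> carrier G \<Longrightarrow> conj_by g a = a \<otimes> commutator G a g"
  by (simp add: word_simps)

lemma conj_by_commutator:
  "a \<in> carrier G \<Longrightarrow> b \<in> carrier G \<Longrightarrow> g \<in> carrier G \<Longrightarrow>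
    conj_by g (commutator G a b) = commutator G (conj_by g a) (conj_by g b)"
  by (simp add: word_simps)

lemma commutator_eq_one_iff:
  assumes "a \<in> carrier G" "b \<in> carrier G"
  shows "commutator G a b = \<one> \<longleftrightarrow> a \<otimes> b = b \<otimes> a"
proof
  assume "commutator G a b = \<one>"
  then have "conj_by b a = a" using conj_by_eq[OF assms] assms by simp
  then have "b \<otimes> conj_by b a = b \<otimes> a" by simp
  then show "a \<otimes> b = b \<otimes> a" using assms by (simp add: word_simps)
next
  assume "a \<otimes> b = b \<otimes> a"
  then show "commutator G a b = \<one>" using assms by (simp add: word_simps)
qed

text \<open>This is the centralizer of \<open>a\<close> modulo \<open>N\<close>.\<close>

lemma subgroup_commutator_left:
  assumes N: "N \<lhd> G" and a: "a \<in> carrier G"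
  shows "subgroup {g \<in> carrier G. commutator G g a \<in> N} G"
proof -
  interpret N: normal N G by (rule N)
  show ?thesis
  proof (rule subgroupI)
    show "{g \<in> carrier G. commutator G g a \<in> N} \<noteq> {}"
      using a commutator_one N.one_closed by (auto intro!: exI[of _ \<one>])
  next
    fix g assume "g \<in> {g \<in> carrier G. commutator G g a \<in> N}"
    then show "inv g \<in> {g \<in> carrier G. commutator G g a \<in> N}"
      using N.inv_op_closed1[of "inv g"] a commutator_inv_left[of a g] by simp
  next
    fix g h assume "g \<in> {g \<in> carrier G. commutator G g a \<in> N}"
      "h \<in> {g \<in> carrier G. commutator G g a \<in> N}"
    then show "g \<otimes> h \<in> {g \<in> carrier G. commutator G g a \<in> N}"
      using N.inv_op_closed1[of h "commutator G g a"] a commutator_mult_left[of g h a] by simp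
  qed auto
qed

lemma subgroup_commutator_right:
  assumes N: "N \<lhd> G" and a: "a \<in> carrier G"
  shows "subgroup {g \<in> carrier G. commutator G a g \<in> N} G"
proof -
  have "commutator G a g \<in> N \<longleftrightarrow> commutator G g a \<in> N" if "g \<in> carrier G" for g
    using inv_commutator[OF a that] inv_commutator[OF that a] normal_imp_subgroup[OF N]
    by (metis subgroup.m_inv_closed)
  then show ?thesis using subgroup_commutator_left[OF assms] by (metis (no_types, lifting) Collect_cong)
qed

text \<open>Modulo \<open>N\<close> the generators commute, hence so do all elements that they generate.\<close>

lemma derived_generate_le:
  assumes N: "N \<lhd> G" and K: "K \<subseteq> carrier G"
    and comm: "\<And>k k'. k \<in> K \<Longrightarrow> k' \<in> K \<Longrightarrow> commutator G k k' \<in> N"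
  shows "derived G (generate G K) \<subseteq> N"
proof -
  have 1: "commutator G g k \<in> N" if "g \<in> generate G K" "k \<in> K" for g k
    using generate_subgroup_incl[OF _ subgroup_commutator_left[OF N], of K k] comm K that by blast
  have 2: "commutator G g h \<in> N" if "g \<in> generate G K" "h \<in> generate G K" for g h
    using generate_subgroup_incl[OF _ subgroup_commutator_right[OF N], of K g]
      1 K that generate_in_carrier[OF K] by blast
  show ?thesis
    unfolding derived_def
  proof (rule generate_subgroup_incl[OF _ normal_imp_subgroup[OF N]], clarify)
    fix g h assume gh: "g \<in> generate G K" "h \<in> generate G K"
    then have "g \<otimes> h \<otimes> inv g \<otimes> inv h = commutator G (inv g) (inv h)"
      using generate_in_carrier[OF K] by (simp add: commutator_def)
    then show "g \<otimes> h \<otimes> inv g \<otimes> inv h \<in> N"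
      using 2 gh generate_m_inv_closed[OF K] by simp
  qed
qed

lemma commutator_mem_derived:
  assumes "subgroup U G" "g \<in> U" "h \<in> U"
  shows "commutator G g h \<in> derived G U"
proof -
  have "commutator G g h = inv g \<otimes> inv h \<otimes> inv (inv g) \<otimes> inv (inv h)"
    using subgroup.mem_carrier[OF assms(1)] assms(2,3) by (simp add: commutator_def)
  moreover have "inv g \<in> U" "inv h \<in> U"
    using subgroup.m_inv_closed[OF assms(1)] assms(2,3) by blast+
  ultimately show ?thesis unfolding derived_def by (intro generate.incl) blast
qed

lemma commutator_subgroup_normal:
  assumes N: "N \<lhd> G"
  shows "commutator_subgroup G N (carrier G) \<lhd> G"
  unfolding commutator_subgroup_def
proof (rule normal_generateI)
  note sub = subgroup.mem_carrier[OF normal_imp_subgroup[OF N]]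
  show "{commutator G h k |h k. h \<in> N \<and> k \<in> carrier G} \<subseteq> carrier G" using sub by auto
  fix a g assume "a \<in> {commutator G h k |h k. h \<in> N \<and> k \<in> carrier G}" and g: "g \<in> carrier G"
  then obtain h k where a: "a = commutator G h k" and h: "h \<in> N" and k: "k \<in> carrier G" by blast
  have "g \<otimes> a \<otimes> inv g = commutator G (conj_by (inv g) h) (conj_by (inv g) k)"
    using conj_by_commutator[of h k "inv g"] sub[OF h] k g a by simp
  moreover have "conj_by (inv g) h \<in> N" using normal.inv_op_closed1[OF N, of "inv g" h] g h by simp
  ultimately show "g \<otimes> a \<otimes> inv g \<in> {commutator G h k |h k. h \<in> N \<and> k \<in> carrier G}"
    using g k by blast
qed

lemma commutator_subgroup_le:
  assumes N: "N \<lhd> G"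
  shows "commutator_subgroup G N (carrier G) \<subseteq> N"
  unfolding commutator_subgroup_def
proof (rule generate_subgroup_incl[OF _ normal_imp_subgroup[OF N]], clarify)
  fix h k assume h: "h \<in> N" and k: "k \<in> carrier G"
  note sub = subgroup.mem_carrier[OF normal_imp_subgroup[OF N] h]
  have "commutator G h k = inv h \<otimes> conj_by k h" using sub k by (simp add: commutator_def m_assoc)
  then show "commutator G h k \<in> N"
    using normal.inv_op_closed1[OF N k h] h normal_imp_subgroup[OF N]
    by (simp add: subgroup.m_closed subgroup.m_inv_closed)
qed

lemma lower_central_Suc:
  "1 \<le> j \<Longrightarrow> lower_central G (Suc j) = commutator_subgroup G (lower_central G j) (carrier G)"
  by (cases j) simp_all

lemma carrier_normal: "carrier G \<lhd> G"
  by (simp add: normal_inv_iff subgroup_self)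

lemma lower_central_normal: "1 \<le> j \<Longrightarrow> lower_central G j \<lhd> G"
proof (induction j rule: dec_induct)
  case base
  show ?case using carrier_normal by simp
next
  case (step j)
  then show ?case by (simp add: lower_central_Suc commutator_subgroup_normal)
qed

lemma lower_central_decreasing: "1 \<le> j \<Longrightarrow> lower_central G (Suc j) \<subseteq> lower_central G j"
  using commutator_subgroup_le[OF lower_central_normal] by (simp add: lower_central_Suc)

lemma commutator_mem_lower_central:
  "1 \<le> j \<Longrightarrow> a \<in> lower_central G j \<Longrightarrow> g \<in> carrier G \<Longrightarrow> commutator G a g \<in> lower_central G (Suc j)"
  unfolding lower_central_Suc commutator_subgroup_def by (rule generate.incl) blast

lemma lower_central_2: "lower_central G 2 = derived G (carrier G)"
proof
  have eq: "lower_central G 2 = commutator_subgroup G (carrier G) (carrier G)"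
    by (simp add: numeral_2_eq_2)
  show "lower_central G 2 \<subseteq> derived G (carrier G)"
    unfolding eq commutator_subgroup_def
    by (rule generate_subgroup_incl[OF _ derived_is_subgroup[OF order_refl]])
      (auto intro: commutator_mem_derived[OF subgroup_self])
  have "derived G (generate G (carrier G)) \<subseteq> lower_central G 2"
    unfolding eq
    by (rule derived_generate_le[OF commutator_subgroup_normal[OF carrier_normal] order_refl])
      (auto simp: commutator_subgroup_def intro: generate.incl)
  then show "derived G (carrier G) \<subseteq> lower_central G 2"
    using generate_subgroup_incl[OF order_refl subgroup_self] generate.incl[of _ "carrier G" G]
    by (metis subset_antisym subsetI)
qed

lemma metabelian_commute:
  assumes "metabelian G" "a \<in> derived G (carrier G)" "b \<in> derived G (carrier G)"
  shows "a \<otimes> b = b \<otimes> a"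
proof -
  have sg: "subgroup (derived G (carrier G)) G" by (rule derived_is_subgroup) simp
  have "commutator G a b \<in> derived G (derived G (carrier G))"
    by (rule commutator_mem_derived[OF sg assms(2,3)])
  then show ?thesis
    using assms commutator_eq_one_iff subgroup.mem_carrier[OF sg] by (simp add: metabelian_def)
qed

text \<open>The set of all elements that centralize the section is itself a subgroup, hence the biggest one.\<close>

lemma two_step_centralizer_eq:
  assumes "1 \<le> j"
  shows "two_step_centralizer G j =
    {g \<in> carrier G. \<forall>h \<in> lower_central G j. commutator G g h \<in> lower_central G (j + 2)}"
    (is "_ = ?C")
proof -
  have N: "lower_central G (j + 2) \<lhd> G" by (rule lower_central_normal) simp
  note sub = subgroup.mem_carrier[OF normal_imp_subgroup[OF lower_central_normal[OF assms]]]
  have ne: "lower_central G j \<noteq> {}"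
    using subgroup.one_closed[OF normal_imp_subgroup[OF lower_central_normal[OF assms]]] by blast
  have "?C = (\<Inter>h\<in>lower_central G j. {g \<in> carrier G. commutator G g h \<in> lower_central G (j + 2)})"
    using ne by auto
  moreover have "subgroup \<dots> G"
    using ne sub subgroup_commutator_left[OF N]
    by (intro subgroups_Inter) auto
  ultimately have C: "subgroup ?C G" by simp
  show ?thesis
    unfolding two_step_centralizer_def
  proof (rule Greatest_equality)
    show "subgroup ?C G \<and> commutator_subgroup G ?C (lower_central G j) \<subseteq> lower_central G (j + 2)"
      unfolding commutator_subgroup_def
      by (intro conjI C generate_subgroup_incl[OF _ normal_imp_subgroup[OF N]]) auto
    fix H assume "subgroup H G \<and> commutator_subgroup G H (lower_central G j) \<subseteq> lower_central G (j + 2)"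
    then have H: "subgroup H G"
      and le: "generate G {commutator G g h |g h. g \<in> H \<and> h \<in> lower_central G j}
        \<subseteq> lower_central G (j + 2)"
      by (simp_all only: commutator_subgroup_def)
    show "H \<le> ?C"
    proof (intro subsetI CollectI conjI ballI)
      fix g assume g: "g \<in> H"
      then show "g \<in> carrier G" using subgroup.mem_carrier[OF H] by blast
      fix h assume "h \<in> lower_central G j"
      with g have "commutator G g h \<in> {commutator G g h |g h. g \<in> H \<and> h \<in> lower_central G j}"
        by blast
      then show "commutator G g h \<in> lower_central G (j + 2)"
        by (rule subsetD[OF le generate.incl])
    qed
  qed
qed

end

section \<open>The commutator subgroup as a two-chain module\<close>

text \<open>Here \<open>c\<close> is the nilpotency class and \<open>e - 1\<close> the coclass.\<close>

locale metabelian_chain_group = group G for G (structure) +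
  fixes x y :: 'a and c e :: nat
  assumes order: "order G = 3 ^ (c + e - 1)"
    and metab: "metabelian G"
    and class_Suc: "lower_central G (Suc c) = {\<one>}" and class_c: "lower_central G c \<noteq> {\<one>}"
    and c_ge: "4 \<le> c" and e_ge: "3 \<le> e" and e_le: "e \<le> c"
    and order_abelianization: "order (G Mod derived G (carrier G)) = 9"
    and selected: "selected_generators G (Suc c) x y"
begin

abbreviation D :: "'a set" where "D \<equiv> derived G (carrier G)"
abbreviation AG :: "('a, 'b) monoid_scheme" where "AG \<equiv> G\<lparr>carrier := D\<rparr>"
abbreviation \<gamma> :: "nat \<Rightarrow> 'a set" where "\<gamma> \<equiv> lower_central G"
abbreviation \<xi> :: "'a \<Rightarrow> 'a" where "\<xi> \<equiv> \<lambda>a. commutator G a x"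
abbreviation \<eta> :: "'a \<Rightarrow> 'a" where "\<eta> \<equiv> \<lambda>a. commutator G a y"
abbreviation s :: 'a where "s \<equiv> commutator G y x"
abbreviation \<sigma> :: "nat \<Rightarrow> 'a" where "\<sigma> \<equiv> sigma G x y"
abbreviation \<tau> :: "nat \<Rightarrow> 'a" where "\<tau> \<equiv> tau G x y"
abbreviation r :: nat where "r \<equiv> first_two_step_centralizer G (Suc c)"

lemma x_closed [simp]: "x \<in> carrier G" and y_closed [simp]: "y \<in> carrier G"
  and carrier_generate: "carrier G = generate G {x, y}"
  and gamma_3: "\<gamma> 3 = generate G ({y [^] (3::nat), x [^] (3::nat)} \<union> \<gamma> 4)"
  and x_outside: "r < c \<Longrightarrow> x \<notin> two_step_centralizer G r"
  and y_inside: "y \<in> two_step_centralizer G r" and y_notin: "y \<notin> D"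
  using selected unfolding selected_generators_def Let_def by auto

lemma finite_carrier: "finite (carrier G)"
  using order unfolding order_def by (metis card.infinite power_not_zero zero_neq_numeral)

lemma D_normal: "D \<lhd> G" by (rule derived_self_is_normal)
lemma D_subgroup: "subgroup D G" by (rule normal_imp_subgroup[OF D_normal])
lemma D_closed: "a \<in> D \<Longrightarrow> a \<in> carrier G" using subgroup.mem_carrier[OF D_subgroup] .
lemma D_commute: "a \<in> D \<Longrightarrow> b \<in> D \<Longrightarrow> a \<otimes> b = b \<otimes> a" by (rule metabelian_commute[OF metab])
lemma commutator_mem_D: "g \<in> carrier G \<Longrightarrow> h \<in> carrier G \<Longrightarrow> commutator G g h \<in> D"
  by (rule commutator_mem_derived[OF subgroup_self])
lemma D_mult: "a \<in> D \<Longrightarrow> b \<in> D \<Longrightarrow> a \<otimes> b \<in> D" by (rule subgroup.m_closed[OF D_subgroup])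
lemma D_inv: "a \<in> D \<Longrightarrow> inv a \<in> D" by (rule subgroup.m_inv_closed[OF D_subgroup])

lemma gamma_2: "\<gamma> 2 = D" by (rule lower_central_2)
lemma gamma_subset_D: "2 \<le> j \<Longrightarrow> \<gamma> j \<subseteq> D"
proof (induction j rule: dec_induct)
  case (step j)
  then show ?case using lower_central_decreasing[of j] by auto
qed (simp add: gamma_2)

lemma conj_by_D: "a \<in> D \<Longrightarrow> b \<in> D \<Longrightarrow> conj_by b a = a"
  using D_commute[of a b] D_closed by (simp add: inv_mult_cancel m_assoc)

lemma commutator_D_one: "a \<in> D \<Longrightarrow> b \<in> D \<Longrightarrow> commutator G a b = \<one>"
  using D_commute[of a b] commutator_eq_one_iff[of a b] D_closed by simp

lemma commutator_hom:
  assumes "g \<in> carrier G" "a \<in> D" "b \<in> D"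
  shows "commutator G (a \<otimes> b) g = commutator G a g \<otimes> commutator G b g"
  using assms D_closed commutator_mult_left[of a b g] conj_by_D[OF commutator_mem_D] by simp

text \<open>Conjugation by \<open>g\<close> replaces \<open>z\<close> by \<open>z\<close> times an element of the commutator subgroup, which acts
  trivially on the commutator subgroup.  Hence commutation with \<open>z\<close> is equivariant; this yields both
  that \<open>\<xi>\<close> and \<open>\<eta>\<close> commute and that their images are normal.\<close>

lemma conj_by_commutator_D:
  assumes a: "a \<in> D" and g: "g \<in> carrier G" and z: "z \<in> carrier G"
  shows "conj_by g (commutator G a z) = commutator G (conj_by g a) z"
proof -
  have ga: "conj_by g a \<in> D" using normal.inv_op_closed1[OF D_normal g a] .
  have zg: "commutator G z g \<in> D" using commutator_mem_D[OF z g] .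
  have "conj_by g (commutator G a z) = commutator G (conj_by g a) (z \<otimes> commutator G z g)"
    using conj_by_commutator[OF D_closed[OF a] z g] conj_by_eq[OF z g] by simp
  also have "\<dots> = commutator G (conj_by g a) (commutator G z g)
      \<otimes> conj_by (commutator G z g) (commutator G (conj_by g a) z)"
    using commutator_mult_right[of "conj_by g a" z "commutator G z g"] D_closed[OF ga] D_closed[OF zg] z
    by simp
  also have "\<dots> = commutator G (conj_by g a) z"
    using commutator_D_one[OF ga zg] conj_by_D[OF commutator_mem_D zg] D_closed[OF ga] z by simp
  finally show ?thesis .
qed

lemma comm_group_AG: "comm_group AG"
proof (rule group.group_comm_groupI)
  show "group AG" by (rule subgroup_imp_group[OF D_subgroup])
qed (simp add: D_commute)

lemma generate_AG: "K \<subseteq> D \<Longrightarrow> generate AG K = generate G K"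
  using generate_consistent[OF _ D_subgroup] .

lemma pow_AG: "a [^]\<^bsub>AG\<^esub> (k::nat) = a [^] k"
  using nat_pow_consistent[of a k D] by simp

lemma subgroup_AG: "subgroup K AG \<Longrightarrow> subgroup K G"
  using incl_subgroup[OF D_subgroup] .

lemma commutator_gen_le:
  assumes N: "N \<lhd> G" and h: "h \<in> carrier G"
    and "commutator G h x \<in> N" "commutator G h y \<in> N" and g: "g \<in> carrier G"
  shows "commutator G h g \<in> N"
proof -
  have "generate G {x, y} \<subseteq> {g \<in> carrier G. commutator G h g \<in> N}"
    by (rule generate_subgroup_incl[OF _ subgroup_commutator_right[OF N h]]) (simp add: assms(3,4))
  then show ?thesis using g by (simp flip: carrier_generate) blast
qed

lemma image_commutator_normal:
  assumes N: "N \<lhd> G" "N \<subseteq> D" and z: "z \<in> carrier G" and g: "g \<in> carrier G"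
    and a: "a \<in> (\<lambda>a. commutator G a z) ` N"
  shows "g \<otimes> a \<otimes> inv g \<in> (\<lambda>a. commutator G a z) ` N"
proof -
  obtain b where b: "b \<in> N" "a = commutator G b z" using a by blast
  have "g \<otimes> a \<otimes> inv g = commutator G (conj_by (inv g) b) z"
    using conj_by_commutator_D[of b "inv g" z] b N g z by auto
  moreover have "conj_by (inv g) b \<in> N" using normal.inv_op_closed1[OF N(1), of "inv g" b] b g by simp
  ultimately show ?thesis by blast
qed

text \<open>The subgroup on the right is normal, and modulo it the two generators of \<open>G\<close> centralize \<open>\<gamma> j\<close>.\<close>

lemma gamma_Suc:
  assumes "2 \<le> j"
  shows "\<gamma> (Suc j) = generate G (\<xi> ` \<gamma> j \<union> \<eta> ` \<gamma> j)" (is "_ = generate G ?K")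
proof
  have N: "\<gamma> j \<lhd> G" by (rule lower_central_normal) (use assms in simp)
  have sub: "\<gamma> j \<subseteq> D" by (rule gamma_subset_D[OF assms])
  have K: "?K \<subseteq> carrier G" using sub D_closed by auto
  have "g \<otimes> a \<otimes> inv g \<in> ?K" if "a \<in> ?K" "g \<in> carrier G" for a g
    using that image_commutator_normal[OF N sub x_closed that(2), of a]
      image_commutator_normal[OF N sub y_closed that(2), of a] by blast
  then have W: "generate G ?K \<lhd> G" by (rule normal_generateI[OF K])
  have mem: "commutator G h g \<in> generate G ?K" if h: "h \<in> \<gamma> j" and g: "g \<in> carrier G" for h g
  proof (rule commutator_gen_le[OF W _ _ _ g])
    show "h \<in> carrier G" using h sub D_closed by blast
    show "\<xi> h \<in> generate G ?K" "\<eta> h \<in> generate G ?K" by (rule generate.incl; use h in simp)+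
  qed
  have "{commutator G h g |h g. h \<in> \<gamma> j \<and> g \<in> carrier G} \<subseteq> generate G ?K"
    by (clarify, rule mem)
  then show "\<gamma> (Suc j) \<subseteq> generate G ?K"
    using lower_central_Suc[of j] assms generate_subgroup_incl[OF _ normal_imp_subgroup[OF W]]
    by (simp add: commutator_subgroup_def)
  show "generate G ?K \<subseteq> \<gamma> (Suc j)"
    by (intro generate_subgroup_incl normal_imp_subgroup lower_central_normal)
      (use assms commutator_mem_lower_central[of j] in auto)
qed

text \<open>The subgroup on the right is normal, and modulo it the two generators of \<open>G\<close> commute.\<close>

lemma D_generate: "D = generate G (insert s (\<gamma> 3))" (is "_ = ?N")
proof
  have 3: "\<gamma> 3 \<lhd> G" by (rule lower_central_normal) simp
  have sD: "s \<in> D" by (rule commutator_mem_D) simp_all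
  have s: "s \<in> carrier G" by simp
  have sub: "insert s (\<gamma> 3) \<subseteq> D" using sD gamma_subset_D[of 3] by simp
  then have sub': "insert s (\<gamma> 3) \<subseteq> carrier G" using D_closed by blast
  have sg: "subgroup ?N G" by (rule generate_is_subgroup[OF sub'])
  have N: "?N \<lhd> G"
  proof (rule normal_invI[OF sg])
    fix g h assume g: "g \<in> carrier G" and h: "h \<in> ?N"
    have "subgroup {h \<in> carrier G. g \<otimes> h \<otimes> inv g \<in> ?N} G"
    proof (rule subgroupI)
      show "{h \<in> carrier G. g \<otimes> h \<otimes> inv g \<in> ?N} \<noteq> {}"
        using g subgroup.one_closed[OF sg] by (auto intro!: exI[of _ \<one>])
    next
      fix a assume "a \<in> {h \<in> carrier G. g \<otimes> h \<otimes> inv g \<in> ?N}"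
      then have a: "a \<in> carrier G" "inv (g \<otimes> a \<otimes> inv g) \<in> ?N"
        using subgroup.m_inv_closed[OF sg] by auto
      moreover have "inv (g \<otimes> a \<otimes> inv g) = g \<otimes> inv a \<otimes> inv g" using a(1) g by (simp add: word_simps)
      ultimately show "inv a \<in> {h \<in> carrier G. g \<otimes> h \<otimes> inv g \<in> ?N}" by simp
    next
      fix a b assume "a \<in> {h \<in> carrier G. g \<otimes> h \<otimes> inv g \<in> ?N}" "b \<in> {h \<in> carrier G. g \<otimes> h \<otimes> inv g \<in> ?N}"
      then have ab: "a \<in> carrier G" "b \<in> carrier G" "(g \<otimes> a \<otimes> inv g) \<otimes> (g \<otimes> b \<otimes> inv g) \<in> ?N"
        using subgroup.m_closed[OF sg] by auto
      moreover have "(g \<otimes> a \<otimes> inv g) \<otimes> (g \<otimes> b \<otimes> inv g) = g \<otimes> (a \<otimes> b) \<otimes> inv g"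
        using ab g by (simp add: word_simps)
      ultimately show "a \<otimes> b \<in> {h \<in> carrier G. g \<otimes> h \<otimes> inv g \<in> ?N}" by simp
    qed auto
    moreover have "g \<otimes> s \<otimes> inv g \<in> ?N"
    proof -
      have "g \<otimes> s \<otimes> inv g = s \<otimes> commutator G s (inv g)"
        using conj_by_eq[of s "inv g"] g by simp
      moreover have "commutator G s (inv g) \<in> \<gamma> 3"
        using commutator_mem_lower_central[of 2 s "inv g"] sD g gamma_2 by (simp add: eval_nat_numeral)
      ultimately show ?thesis using subgroup.m_closed[OF sg] by (simp add: generate.incl)
    qed
    moreover have "g \<otimes> b \<otimes> inv g \<in> ?N" if "b \<in> \<gamma> 3" for b
      using normal.inv_op_closed2[OF 3 g that] by (simp add: generate.incl)
    ultimately have "insert s (\<gamma> 3) \<subseteq> {h \<in> carrier G. g \<otimes> h \<otimes> inv g \<in> ?N}"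
      using sub' by auto
    then show "g \<otimes> h \<otimes> inv g \<in> ?N"
      using h generate_subgroup_incl[OF _ \<open>subgroup {h \<in> carrier G. g \<otimes> h \<otimes> inv g \<in> ?N} G\<close>] by blast
  qed
  have sN: "s \<in> ?N" by (simp add: generate.incl)
  have "commutator G k k' \<in> ?N" if "k \<in> {x, y}" "k' \<in> {x, y}" for k k'
  proof -
    have "commutator G x y \<in> ?N"
      using subgroup.m_inv_closed[OF sg sN] inv_commutator[OF y_closed x_closed] by simp
    then show ?thesis using that sN commutator_one(3) subgroup.one_closed[OF sg] by auto
  qed
  then have "derived G (generate G {x, y}) \<subseteq> ?N" by (intro derived_generate_le[OF N]) auto
  then show "D \<subseteq> ?N" by (simp flip: carrier_generate)
  show "?N \<subseteq> D" by (rule generate_subgroup_incl[OF sub D_subgroup])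
qed

lemma \<gamma>_3_pow: "y [^] (3::nat) \<in> \<gamma> 3" "x [^] (3::nat) \<in> \<gamma> 3"
  unfolding gamma_3 by (simp_all add: generate.incl)

text \<open>Expanding the commutator of the cube of \<open>y\<close> with \<open>x\<close> gives the cube of \<open>s\<close> up to factors in
  \<open>\<gamma> 3\<close>; but the cube of \<open>y\<close> lies in the commutator subgroup, so its commutator with \<open>x\<close> lies in
  \<open>\<gamma> 3\<close>, too.\<close>

lemma s_cube: "s [^] (3::nat) \<in> \<gamma> 3"
proof -
  interpret AG: comm_group AG by (rule comm_group_AG)
  have 3: "\<gamma> 3 \<lhd> G" by (rule lower_central_normal) simp
  note sg = normal_imp_subgroup[OF 3]
  have eta3: "\<eta> a \<in> \<gamma> 3" if "a \<in> D" for a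
    using commutator_mem_lower_central[of 2 a y] that gamma_2 by (simp add: eval_nat_numeral)
  have s: "s \<in> D" by (rule commutator_mem_D) simp_all
  have sc: "s \<in> carrier G" by simp
  define p where "p = commutator G (y \<otimes> y) x"
  have pD: "p \<in> D" unfolding p_def by (rule commutator_mem_D) simp_all
  have es: "\<eta> s \<in> D" "\<eta> p \<in> D" by (rule commutator_mem_D; use pD D_closed in simp)+
  have p: "p = s \<otimes> \<eta> s \<otimes> s"
    unfolding p_def using commutator_mult_left[of y y x] conj_by_eq[of s y] by simp
  have "commutator G (y [^] (3::nat)) x = p \<otimes> \<eta> p \<otimes> s"
    using commutator_mult_left[of "y \<otimes> y" y x] conj_by_eq[of p y] D_closed[OF pD]
    by (simp add: numeral_3_eq_3 p_def)
  also have "\<dots> = s [^] (3::nat) \<otimes> (\<eta> s \<otimes> \<eta> p)"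
  proof -
    have "(s \<otimes> \<eta> s \<otimes> s) \<otimes> \<eta> p \<otimes> s = (s \<otimes> s \<otimes> s) \<otimes> (\<eta> s \<otimes> \<eta> p)"
      using s es by (simp add: AG.m_ac[simplified] D_mult)
    then show ?thesis using sc by (subst (1) p) (simp add: numeral_3_eq_3)
  qed
  finally have eq: "commutator G (y [^] (3::nat)) x = s [^] (3::nat) \<otimes> (\<eta> s \<otimes> \<eta> p)" .
  have "y [^] (3::nat) \<in> D" using \<gamma>_3_pow gamma_subset_D[of 3] by auto
  then have "commutator G (y [^] (3::nat)) x \<in> \<gamma> 3"
    using commutator_mem_lower_central[of 2 "y [^] (3::nat)" x] gamma_2 by (simp add: eval_nat_numeral)
  moreover have w: "\<eta> s \<otimes> \<eta> p \<in> \<gamma> 3"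
    using subgroup.m_closed[OF sg eta3[OF s] eta3[OF pD]] .
  ultimately have "(s [^] (3::nat) \<otimes> (\<eta> s \<otimes> \<eta> p)) \<otimes> inv (\<eta> s \<otimes> \<eta> p) \<in> \<gamma> 3"
    using subgroup.m_closed[OF sg] subgroup.m_inv_closed[OF sg] eq by simp
  moreover have "\<eta> s \<otimes> \<eta> p \<in> carrier G" "s [^] (3::nat) \<in> carrier G" using es D_closed by simp_all
  ultimately show ?thesis by (simp add: m_assoc)
qed

lemma card_D: "card D = 3 ^ (c + e - 3)"
proof -
  have "card (rcosets D) = 9" using order_abelianization by (simp add: order_def FactGroup_def)
  then have "9 * card D = 3 ^ (c + e - 1)" using lagrange[OF D_subgroup] order by simp
  also have "c + e - 1 = Suc (Suc (c + e - 3))" using c_ge by simp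
  finally show ?thesis by simp
qed

lemma sigma_Suc: "3 \<le> j \<Longrightarrow> \<sigma> (Suc j) = \<xi> (\<sigma> j)" and tau_Suc: "3 \<le> j \<Longrightarrow> \<tau> (Suc j) = \<eta> (\<tau> j)"
  by (simp_all only: sigma_def tau_def Suc_diff_le funpow.simps o_apply)

lemma xi_eta_commute:
  assumes a: "a \<in> D"
  shows "\<xi> (\<eta> a) = \<eta> (\<xi> a)"
proof -
  have D: "\<xi> a \<in> D" "\<eta> a \<in> D" "\<eta> (\<xi> a) \<in> D"
    by (rule commutator_mem_D; use a D_closed in simp)+
  have "\<eta> a \<otimes> \<xi> (\<eta> a) = conj_by x (\<eta> a)" using conj_by_eq[of "\<eta> a" x] a D_closed by simp
  also have "\<dots> = \<eta> (conj_by x a)" using conj_by_commutator_D[OF a x_closed y_closed] .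
  also have "conj_by x a = a \<otimes> \<xi> a" using conj_by_eq a D_closed by simp
  also have "\<eta> (a \<otimes> \<xi> a) = \<eta> a \<otimes> \<eta> (\<xi> a)" using commutator_hom[OF y_closed a D(1)] .
  finally show ?thesis using D D_closed a by simp
qed

sublocale M: two_chain_module AG \<xi> \<eta> s \<sigma> \<tau> \<gamma> c e
proof -
  interpret AG: comm_group AG by (rule comm_group_AG)
  have hom: "(\<lambda>a. commutator G a z) \<in> hom AG AG" if "z \<in> carrier G" for z
    using that commutator_hom commutator_mem_D D_closed by (auto simp: hom_def)
  have pow_comm: "commutator G (z [^] (3::nat)) z = \<one>" if "z \<in> carrier G" for z
    using that commutator_eq_one_iff[of "z [^] (3::nat)" z] by (simp add: numeral_3_eq_3 m_assoc)
  have "insert s (\<gamma> 3) \<subseteq> D" using gamma_subset_D[of 3] commutator_mem_D by simp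
  note gen_D = generate_AG[OF this]
  have "{\<sigma> 3, \<tau> 3} \<union> \<gamma> 4 \<subseteq> D"
    using gamma_subset_D[of 3] gamma_subset_D[of 4] \<gamma>_3_pow by (auto simp: sigma_def tau_def)
  note gen_3 = generate_AG[OF this]
  have gen_Suc: "generate AG (\<xi> ` \<gamma> j \<union> \<eta> ` \<gamma> j) = generate G (\<xi> ` \<gamma> j \<union> \<eta> ` \<gamma> j)" if "2 \<le> j" for j
    by (rule generate_AG) (use gamma_subset_D[OF that] D_closed in \<open>auto intro!: commutator_mem_D\<close>)
  show "two_chain_module AG \<xi> \<eta> s \<sigma> \<tau> \<gamma> c e"
  proof unfold_locales
    show "finite (carrier AG)" using finite_subset[OF _ finite_carrier] D_closed by auto
    show "\<xi> \<in> hom AG AG" "\<eta> \<in> hom AG AG" by (simp_all add: hom)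
    show "\<xi> (\<eta> a) = \<eta> (\<xi> a)" if "a \<in> carrier AG" for a using xi_eta_commute that by simp
    show "s \<in> carrier AG" by (simp add: commutator_mem_D)
    show "s [^]\<^bsub>AG\<^esub> (3::nat) \<in> \<gamma> 3" using s_cube by (simp add: pow_AG)
    show "\<gamma> 2 = carrier AG" by (simp add: gamma_2)
    show "\<gamma> (Suc j) = generate AG (\<xi> ` \<gamma> j \<union> \<eta> ` \<gamma> j)" if "2 \<le> j" for j
      using gamma_Suc[OF that] gen_Suc[OF that] by simp
    show "carrier AG = generate AG (insert s (\<gamma> 3))" using D_generate gen_D by simp
    show "\<gamma> 3 = generate AG ({\<sigma> 3, \<tau> 3} \<union> \<gamma> 4)"
      using gamma_3 gen_3 by (simp add: sigma_def tau_def)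
    show "\<sigma> (Suc j) = \<xi> (\<sigma> j)" "\<tau> (Suc j) = \<eta> (\<tau> j)" if "3 \<le> j" for j
      using sigma_Suc tau_Suc that by simp_all
    show "\<eta> (\<sigma> 3) = \<one>\<^bsub>AG\<^esub>" "\<xi> (\<tau> 3) = \<one>\<^bsub>AG\<^esub>" by (simp_all add: sigma_def tau_def pow_comm)
    show "\<gamma> (Suc c) = {\<one>\<^bsub>AG\<^esub>}" "\<gamma> c \<noteq> {\<one>\<^bsub>AG\<^esub>}" using class_Suc class_c by simp_all
    show "card (carrier AG) = 3 ^ (c + e - 3)" by (simp add: card_D)
  qed (rule c_ge e_ge e_le)+
qed

end

section \<open>Two-step centralizers, the centre, and the derived maximal subgroups\<close>

context metabelian_chain_group
begin

lemma M_hom_closed: "a \<in> D \<Longrightarrow> \<xi> a \<in> D" "a \<in> D \<Longrightarrow> \<eta> a \<in> D"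
  by (rule commutator_mem_D; use D_closed in simp)+

text \<open>Otherwise \<open>\<xi>\<close> would annihilate \<open>s\<close>, contrary to the independence of \<open>\<xi> s\<close> and \<open>\<eta> s\<close>.\<close>

lemma x_notin: "x \<notin> D"
proof
  assume "x \<in> D"
  then have "\<xi> s = \<one>" using commutator_D_one[OF commutator_mem_D] by simp
  moreover have "s \<in> D" "\<eta> s \<in> carrier G" using commutator_mem_D by simp_all
  ultimately show False
    using M.\<xi>_s_\<eta>_s_independent[unfolded M.independent_mod_def, rule_format, of 1 0]
      subgroup.one_closed[OF normal_imp_subgroup[OF lower_central_normal[of 4]]]
    by (simp add: pow_AG)
qed

lemma centralizer_iff:
  assumes "1 \<le> j" "g \<in> carrier G"
  shows "g \<in> two_step_centralizer G j \<longleftrightarrow> (\<forall>a\<in>\<gamma> j. commutator G a g \<in> \<gamma> (Suc (Suc j)))"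
proof -
  have sg: "subgroup (\<gamma> (Suc (Suc j))) G"
    by (rule normal_imp_subgroup[OF lower_central_normal]) simp
  have "commutator G g a \<in> \<gamma> (Suc (Suc j)) \<longleftrightarrow> commutator G a g \<in> \<gamma> (Suc (Suc j))" if "a \<in> \<gamma> j" for a
  proof -
    have "a \<in> carrier G"
      using that subgroup.mem_carrier[OF normal_imp_subgroup[OF lower_central_normal[OF assms(1)]]] by blast
    then show ?thesis
      using inv_commutator[of a g] inv_commutator[of g a] assms(2) subgroup.m_inv_closed[OF sg] by metis
  qed
  then show ?thesis using two_step_centralizer_eq[OF assms(1)] assms(2) by simp
qed

lemma D_subset_centralizer:
  assumes "2 \<le> j"
  shows "D \<subseteq> two_step_centralizer G j"
proof
  fix g assume g: "g \<in> D"
  have "commutator G a g \<in> \<gamma> (Suc (Suc j))" if "a \<in> \<gamma> j" for a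
  proof -
    have "commutator G a g = \<one>" using commutator_D_one g that gamma_subset_D[OF assms] by blast
    then show ?thesis
      using subgroup.one_closed[OF normal_imp_subgroup[OF lower_central_normal[of "Suc (Suc j)"]]] by simp
  qed
  then show "g \<in> two_step_centralizer G j" using centralizer_iff[of j g] assms g D_closed by simp
qed

lemma centralizer_c: "two_step_centralizer G c = carrier G"
proof -
  have "g \<in> two_step_centralizer G c" if g: "g \<in> carrier G" for g
  proof -
    have "commutator G a g \<in> \<gamma> (Suc (Suc c))" if "a \<in> \<gamma> c" for a
    proof -
      have "commutator G a g = \<one>"
        using commutator_mem_lower_central[of c a g] that g class_Suc c_ge by simp
      then show ?thesis
        using subgroup.one_closed[OF normal_imp_subgroup[OF lower_central_normal[of "Suc (Suc c)"]]] by simp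
    qed
    then show ?thesis using centralizer_iff[of c g] c_ge g by simp
  qed
  moreover have "two_step_centralizer G c \<subseteq> carrier G"
    using two_step_centralizer_eq[of c] c_ge by auto
  ultimately show ?thesis by blast
qed

lemma
  shows r_ge: "2 \<le> r" and r_le: "r \<le> c"
    and r_minimal: "2 \<le> j \<Longrightarrow> j < r \<Longrightarrow> two_step_centralizer G j = D"
proof -
  let ?J = "{j \<in> {2..c}. D \<subset> two_step_centralizer G j}"
  have r: "r = Min ?J" by (simp add: first_two_step_centralizer_def)
  have fin: "finite ?J" by simp
  have "D \<subset> carrier G" using D_closed y_notin y_closed by blast
  then have "c \<in> ?J" using centralizer_c c_ge by simp
  then have "r \<in> ?J" using Min_in[OF fin] r by (simp only: empty_iff) blast
  then show "2 \<le> r" and "r \<le> c" by auto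
  show "two_step_centralizer G j = D" if j: "2 \<le> j" "j < r"
  proof (rule ccontr)
    assume "two_step_centralizer G j \<noteq> D"
    then have "D \<subset> two_step_centralizer G j" using D_subset_centralizer[OF j(1)] by blast
    then have "j \<in> ?J" using j \<open>r \<le> c\<close> by simp
    then have "r \<le> j" unfolding r by (rule Min_le[OF fin])
    then show False using j(2) by simp
  qed
qed

sublocale M: selected_two_chain_module AG \<xi> \<eta> s \<sigma> \<tau> \<gamma> c e r
proof unfold_locales
  show "2 \<le> r" "r \<le> c" by (rule r_ge r_le)+
  show "\<eta> a \<in> \<gamma> (Suc (Suc r))" if "a \<in> \<gamma> r" for a
    using y_inside centralizer_iff[of r y] r_ge that by simp
  show "\<exists>a\<in>\<gamma> r. \<xi> a \<notin> \<gamma> (Suc (Suc r))" if "r < c"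
    using x_outside[OF that] centralizer_iff[of r x] r_ge by simp
  show "\<exists>a\<in>\<gamma> j. \<xi> a \<notin> \<gamma> (Suc (Suc j))" if "2 \<le> j" "j < r" for j
    using r_minimal[OF that] x_notin centralizer_iff[of j x] that by simp
  show "\<exists>a\<in>\<gamma> j. \<eta> a \<notin> \<gamma> (Suc (Suc j))" if "2 \<le> j" "j < r" for j
    using r_minimal[OF that] y_notin centralizer_iff[of j y] that by simp
qed

text \<open>Modulo the commutator subgroup, \<open>G\<close> is abelian, and the cubes of \<open>x\<close> and \<open>y\<close> are trivial.\<close>

lemma coset_generators:
  assumes g: "g \<in> carrier G"
  obtains k l a where "k < 3" "l < 3" "a \<in> D" "g = a \<otimes> (x [^] (k::nat) \<otimes> y [^] (l::nat))"
proof -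
  interpret DN: normal D G by (rule D_normal)
  interpret Q: comm_group "G Mod D" by (rule derived_quot_is_comm_group)
  interpret \<pi>: group_hom G "G Mod D" "\<lambda>a. D #> a"
    by unfold_locales (rule DN.r_coset_hom_Mod)
  have cube: "(D #> z) [^]\<^bsub>G Mod D\<^esub> (3::nat) \<in> {\<one>\<^bsub>G Mod D\<^esub>}"
    if "z \<in> carrier G" "z [^] (3::nat) \<in> \<gamma> 3" for z
  proof -
    have "z [^] (3::nat) \<in> D" using that gamma_subset_D[of 3] by auto
    then have "D #> (z [^] (3::nat)) = \<one>\<^bsub>G Mod D\<^esub>"
      using DN.rcos_const by (simp add: FactGroup_def)
    then show ?thesis using \<pi>.hom_nat_pow[OF that(1), of 3] by simp
  qed
  have "(\<lambda>a. D #> a) ` generate G {x, y} = generate (G Mod D) ((\<lambda>a. D #> a) ` {x, y})"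
    by (rule \<pi>.generate_img[symmetric]) simp
  then have "D #> g \<in> generate (G Mod D) {D #> x, D #> y}"
    using g by (simp flip: carrier_generate) blast
  also have "\<dots> \<subseteq> generate (G Mod D) ({D #> x, D #> y} \<union> {\<one>\<^bsub>G Mod D\<^esub>})"
    by (rule Q.mono_generate) simp
  finally obtain k l h where kl: "k < 3" "l < 3" and h: "h \<in> {\<one>\<^bsub>G Mod D\<^esub>}"
    and eq: "D #> g = (D #> x) [^]\<^bsub>G Mod D\<^esub> (k::nat) \<otimes>\<^bsub>G Mod D\<^esub>
      ((D #> y) [^]\<^bsub>G Mod D\<^esub> (l::nat) \<otimes>\<^bsub>G Mod D\<^esub> h)"
    using Q.generate_insert2_cube[OF Q.triv_subgroup \<pi>.hom_closed[OF x_closed] cube[OF x_closed \<gamma>_3_pow(2)]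
        \<pi>.hom_closed[OF y_closed] cube[OF y_closed \<gamma>_3_pow(1)]] by metis
  have yl: "(D #> y) [^]\<^bsub>G Mod D\<^esub> l \<otimes>\<^bsub>G Mod D\<^esub> h = (D #> y) [^]\<^bsub>G Mod D\<^esub> l"
    unfolding singletonD[OF h] by (rule Q.r_one[OF Q.nat_pow_closed[OF \<pi>.hom_closed[OF y_closed]]])
  have "D #> g = D #> (x [^] k \<otimes> y [^] l)"
    unfolding eq yl unfolding \<pi>.hom_nat_pow[OF x_closed, symmetric] \<pi>.hom_nat_pow[OF y_closed, symmetric]
    by (rule \<pi>.hom_mult[symmetric]) simp_all
  moreover have "g \<in> D #> g" using rcos_self[OF g D_subgroup] .
  ultimately have "g \<in> D #> (x [^] k \<otimes> y [^] l)" by simp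
  then obtain a where "a \<in> D" "g = a \<otimes> (x [^] k \<otimes> y [^] l)" by (auto simp: r_coset_def)
  then show ?thesis using that kl by blast
qed

text \<open>Modulo \<open>\<gamma> 4\<close>, commutation with \<open>s\<close> is a homomorphism.  The factors \<open>v\<close>, \<open>v'\<close> record values known
  only modulo \<open>\<gamma> 4\<close>.\<close>

lemma commutator_s_mult:
  assumes g: "g \<in> carrier G" "commutator G s g = u \<otimes> v" and h: "h \<in> carrier G" "commutator G s h = u' \<otimes> v'"
    and u: "u \<in> D" "u' \<in> D" and v: "v \<in> \<gamma> 4" "v' \<in> \<gamma> 4"
  shows "\<exists>w \<in> \<gamma> 4. commutator G s (g \<otimes> h) = (u \<otimes> u') \<otimes> w"
proof -
  have sg: "subgroup (\<gamma> 4) G" by (rule normal_imp_subgroup[OF lower_central_normal]) simp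
  have sD: "s \<in> D" by (rule commutator_mem_D) simp_all
  let ?b = "commutator G s g"
  have bD: "?b \<in> D" by (rule commutator_mem_D) (use g in simp_all)
  have "?b \<in> \<gamma> 3"
    using commutator_mem_lower_central[of 2 s g] sD g(1) gamma_2 by (simp add: eval_nat_numeral)
  then have w: "commutator G ?b h \<in> \<gamma> 4"
    using commutator_mem_lower_central[of 3 ?b h] h(1) by (simp add: eval_nat_numeral)
  have D: "v \<in> D" "v' \<in> D" "commutator G ?b h \<in> D" using v w gamma_subset_D[of 4] by auto
  have "commutator G s (g \<otimes> h) = commutator G s h \<otimes> (?b \<otimes> commutator G ?b h)"
    using commutator_mult_right[of s g h] conj_by_eq[of ?b h] g(1) h(1) by simp
  also have "\<dots> = (u' \<otimes> v') \<otimes> ((u \<otimes> v) \<otimes> commutator G ?b h)" using g(2) h(2) by simp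
  also have "\<dots> = (u \<otimes> u') \<otimes> (v \<otimes> v' \<otimes> commutator G ?b h)"
    using u D by (simp add: M.m_ac[simplified] D_mult)
  finally show ?thesis using subgroup.m_closed[OF sg] v w by blast
qed

lemma commutator_s_pow:
  assumes z: "z \<in> carrier G"
  shows "\<exists>w \<in> \<gamma> 4. commutator G s (z [^] (k::nat)) = commutator G s z [^] k \<otimes> w"
proof (induction k)
  case 0
  have "\<one> \<in> \<gamma> 4" by (rule subgroup.one_closed[OF normal_imp_subgroup[OF lower_central_normal]]) simp
  then show ?case using commutator_one(1)[of s] by (auto intro!: bexI[of _ \<one>])
next
  case (Suc k)
  have sg: "subgroup (\<gamma> 4) G" by (rule normal_imp_subgroup[OF lower_central_normal]) simp
  have zD: "commutator G s z \<in> D" by (rule commutator_mem_D) (use z in simp_all)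
  then have zk: "commutator G s z [^] k \<in> D" by (induction k) (simp_all add: D_mult subgroup.one_closed[OF D_subgroup])
  obtain w where w: "w \<in> \<gamma> 4" "commutator G s (z [^] k) = commutator G s z [^] k \<otimes> w" using Suc by blast
  have "commutator G s z = commutator G s z \<otimes> \<one>" using z by simp
  then show ?case
    using commutator_s_mult[OF nat_pow_closed[OF z] w(2) z _ zk zD w(1) subgroup.one_closed[OF sg]] by simp
qed

text \<open>A central element commutes with \<open>s\<close>.  Modulo \<open>\<gamma> 4\<close> the commutator of \<open>s\<close> with \<open>x\<close> to the power \<open>k\<close>
  times \<open>y\<close> to the power \<open>l\<close> is \<open>\<xi> s\<close> to the power \<open>k\<close> times \<open>\<eta> s\<close> to the power \<open>l\<close>, so that
  independence forces both exponents to vanish.\<close>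

lemma center_subset_D: "center G \<subseteq> D"
proof
  fix g assume g: "g \<in> center G"
  then have gc: "g \<in> carrier G" by (simp add: center_def)
  obtain k l a where kl: "k < 3" "l < 3" and a: "a \<in> D"
    and eq: "g = a \<otimes> (x [^] (k::nat) \<otimes> y [^] (l::nat))"
    using coset_generators[OF gc] .
  have sg: "subgroup (\<gamma> 4) G" by (rule normal_imp_subgroup[OF lower_central_normal]) simp
  have sD: "s \<in> D" by (rule commutator_mem_D) simp_all
  have powD: "b [^] n \<in> D" if "b \<in> D" for b and n :: nat
    using that by (induction n) (simp_all add: D_mult subgroup.one_closed[OF D_subgroup])
  have D: "\<xi> s [^] k \<in> D" "\<eta> s [^] l \<in> D" using powD M_hom_closed sD by simp_all
  note one = subgroup.one_closed[OF sg]
  obtain u where u: "u \<in> \<gamma> 4" "commutator G s (x [^] k) = \<xi> s [^] k \<otimes> u"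
    using commutator_s_pow[OF x_closed] by blast
  obtain v where v: "v \<in> \<gamma> 4" "commutator G s (y [^] l) = \<eta> s [^] l \<otimes> v"
    using commutator_s_pow[OF y_closed] by blast
  have xk: "x [^] k \<in> carrier G" and yl: "y [^] l \<in> carrier G" by simp_all
  obtain w where w: "w \<in> \<gamma> 4" "commutator G s (x [^] k \<otimes> y [^] l) = (\<xi> s [^] k \<otimes> \<eta> s [^] l) \<otimes> w"
    using commutator_s_mult[OF xk u(2) yl v(2) D u(1) v(1)] by blast
  have sa: "commutator G s a = \<one> \<otimes> \<one>" using commutator_D_one[OF sD a] by simp
  obtain w' where w': "w' \<in> \<gamma> 4" "commutator G s g = (\<one> \<otimes> (\<xi> s [^] k \<otimes> \<eta> s [^] l)) \<otimes> w'"
    using commutator_s_mult[OF D_closed[OF a] sa _ w(2) _ D_mult[OF D] one w(1)]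
      subgroup.one_closed[OF D_subgroup] unfolding eq by auto
  have Dc: "\<xi> s [^] k \<otimes> \<eta> s [^] l \<in> carrier G" by simp
  have "commutator G s g = \<one>" using g commutator_eq_one_iff[of s g] gc by (simp add: center_def)
  then have "inv w' = \<xi> s [^] k \<otimes> \<eta> s [^] l"
    using w' Dc subgroup.mem_carrier[OF sg w'(1)] by (simp add: inv_equality)
  then have "\<xi> s [^] k \<otimes> \<eta> s [^] l \<in> \<gamma> 4" using subgroup.m_inv_closed[OF sg w'(1)] by simp
  then have "k = 0 \<and> l = 0"
    using M.\<xi>_s_\<eta>_s_independent[unfolded M.independent_mod_def, rule_format, OF kl] by (simp add: pow_AG)
  then show "g \<in> D" using eq a D_closed by simp
qed

lemma center_eq: "center G = M.fixed"
proof
  show "center G \<subseteq> M.fixed"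
  proof
    fix g assume g: "g \<in> center G"
    then have "g \<in> carrier G" "\<And>h. h \<in> carrier G \<Longrightarrow> g \<otimes> h = h \<otimes> g" by (simp_all add: center_def)
    then show "g \<in> M.fixed"
      using center_subset_D g commutator_eq_one_iff[of g x] commutator_eq_one_iff[of g y]
      by (auto simp: M.fixed_def)
  qed
  show "M.fixed \<subseteq> center G"
  proof
    fix a assume "a \<in> M.fixed"
    then have a: "a \<in> carrier G" "commutator G a x \<in> {\<one>}" "commutator G a y \<in> {\<one>}"
      using D_closed by (simp_all add: M.fixed_def)
    then have "commutator G a g = \<one>" if "g \<in> carrier G" for g
      using commutator_gen_le[OF one_is_normal a that] by simp
    then show "a \<in> center G" using a(1) commutator_eq_one_iff[of a] by (auto simp: center_def)
  qed
qed

abbreviation U :: "nat \<Rightarrow> 'a set" where "U \<equiv> maximal_subgroup G x y"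

text \<open>Commutation with \<open>z\<close> is an endomorphism of the abelian commutator subgroup with a normal image, and
  modulo this image \<open>z\<close> centralizes the commutator subgroup.\<close>

lemma derived_generate_insert_D:
  assumes z: "z \<in> carrier G"
  shows "derived G (generate G (insert z D)) = (\<lambda>a. commutator G a z) ` D"
proof
  have hom: "group_hom AG AG (\<lambda>a. commutator G a z)"
    using comm_group_AG z commutator_hom commutator_mem_D D_closed
    by (auto simp: hom_def group_hom_def group_hom_axioms_def comm_group_def)
  have sg: "subgroup ((\<lambda>a. commutator G a z) ` D) G"
    using subgroup_AG[OF group_hom.img_is_subgroup[OF hom]] by simp
  have N: "(\<lambda>a. commutator G a z) ` D \<lhd> G"
    by (rule normal_invI[OF sg image_commutator_normal[OF D_normal order_refl z]])
  have one: "\<one> \<in> (\<lambda>a. commutator G a z) ` D" by (rule subgroup.one_closed[OF sg])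
  show "derived G (generate G (insert z D)) \<subseteq> (\<lambda>a. commutator G a z) ` D"
  proof (rule derived_generate_le[OF N])
    show "insert z D \<subseteq> carrier G" using z D_closed by blast
    fix k k' assume k: "k \<in> insert z D" "k' \<in> insert z D"
    consider "k = z" "k' = z" | "k \<in> D" "k' = z" | "k = z" "k' \<in> D" | "k \<in> D" "k' \<in> D" using k by blast
    then show "commutator G k k' \<in> (\<lambda>a. commutator G a z) ` D"
    proof cases
      case 1
      then show ?thesis using commutator_one(3)[OF z] one by simp
    next
      case 2
      then show ?thesis by blast
    next
      case 3
      have "commutator G k' z \<in> (\<lambda>a. commutator G a z) ` D" using 3(2) by blast
      then show ?thesis
        using subgroup.m_inv_closed[OF sg] inv_commutator[OF D_closed[OF 3(2)] z] 3(1) by metis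
    next
      case 4
      then show ?thesis using commutator_D_one one by simp
    qed
  qed
  have U: "subgroup (generate G (insert z D)) G"
    by (rule generate_is_subgroup) (use z D_closed in blast)
  show "(\<lambda>a. commutator G a z) ` D \<subseteq> derived G (generate G (insert z D))"
    by (clarify, rule commutator_mem_derived[OF U]) (auto intro: generate.incl)
qed

lemma derived_U_1: "derived G (U 1) = \<eta> ` D" and derived_U_2: "derived G (U 2) = \<xi> ` D"
  using derived_generate_insert_D[OF y_closed] derived_generate_insert_D[OF x_closed]
  by (simp_all add: maximal_subgroup_def)

text \<open>For \<open>z\<close> the product of \<open>x\<close> with \<open>y\<close> or its inverse, both chains are shifted by suitable commutators
  with \<open>z\<close>, and they generate \<open>\<gamma> 4\<close>.\<close>

lemma gamma_c_subset_derived_diagonal: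
  assumes z: "z \<in> carrier G"
    and \<sigma>: "\<And>j. 3 \<le> j \<Longrightarrow> \<exists>a\<in>D. commutator G a z = \<sigma> (Suc j)"
    and \<tau>: "\<And>j. 3 \<le> j \<Longrightarrow> \<exists>a\<in>D. commutator G a z = \<tau> (Suc j)"
  shows "\<gamma> c \<subseteq> derived G (generate G (insert z D))"
  unfolding derived_generate_insert_D[OF z]
proof (rule M.subgroup_ge_\<Gamma>_4[OF _ _ c_ge])
  have hom: "group_hom AG AG (\<lambda>a. commutator G a z)"
    using comm_group_AG z commutator_hom commutator_mem_D D_closed
    by (auto simp: hom_def group_hom_def group_hom_axioms_def comm_group_def)
  show "subgroup ((\<lambda>a. commutator G a z) ` D) AG"
    using group_hom.img_is_subgroup[OF hom] by simp
  fix j :: nat assume "4 \<le> j"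
  then have "3 \<le> j - 1" "Suc (j - 1) = j" by simp_all
  then show "\<sigma> j \<in> (\<lambda>a. commutator G a z) ` D \<and> \<tau> j \<in> (\<lambda>a. commutator G a z) ` D"
    using \<sigma>[of "j - 1"] \<tau>[of "j - 1"] by (metis image_eqI)
qed

lemma \<sigma>_D: "3 \<le> j \<Longrightarrow> \<sigma> j \<in> D" and \<tau>_D: "3 \<le> j \<Longrightarrow> \<tau> j \<in> D"
  using M.\<sigma>_closed[of j] M.\<tau>_closed[of j] by simp_all

lemma gamma_c_subset_derived_U_3: "\<gamma> c \<subseteq> derived G (U 3)"
proof -
  have "\<gamma> c \<subseteq> derived G (generate G (insert (x \<otimes> y) D))"
  proof (rule gamma_c_subset_derived_diagonal)
    fix j :: nat assume j: "3 \<le> j"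
    have \<sigma>: "\<sigma> j \<in> carrier G" "\<sigma> (Suc j) \<in> carrier G" "\<eta> (\<sigma> j) = \<one>" "\<eta> (\<sigma> (Suc j)) = \<one>"
      using \<sigma>_D[of j] \<sigma>_D[of "Suc j"] j D_closed M.\<eta>_\<sigma>[of j] M.\<eta>_\<sigma>[of "Suc j"] by simp_all
    have "commutator G (\<sigma> j) (x \<otimes> y) = conj_by y (\<sigma> (Suc j))"
      using commutator_mult_right[of "\<sigma> j" x y] \<sigma> sigma_Suc[OF j] by simp
    also have "\<dots> = \<sigma> (Suc j)" using conj_by_eq[of "\<sigma> (Suc j)" y] \<sigma> by simp
    finally show "\<exists>a\<in>D. commutator G a (x \<otimes> y) = \<sigma> (Suc j)" using \<sigma>_D[OF j] by blast
    have \<tau>: "\<tau> j \<in> carrier G" "\<xi> (\<tau> j) = \<one>"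
      using \<tau>_D[of j] j D_closed M.\<xi>_\<tau>[of j] by simp_all
    have "commutator G (\<tau> j) (x \<otimes> y) = \<tau> (Suc j)"
      using commutator_mult_right[of "\<tau> j" x y] \<tau> tau_Suc[OF j] by simp
    then show "\<exists>a\<in>D. commutator G a (x \<otimes> y) = \<tau> (Suc j)" using \<tau>_D[OF j] by blast
  qed simp
  then show ?thesis by (simp add: maximal_subgroup_def)
qed

lemma gamma_c_subset_derived_U_4: "\<gamma> c \<subseteq> derived G (U 4)"
proof -
  have "\<gamma> c \<subseteq> derived G (generate G (insert (x \<otimes> inv y) D))"
  proof (rule gamma_c_subset_derived_diagonal)
    have fix_inv: "commutator G a (inv y) = \<one>" if "a \<in> carrier G" "\<eta> a = \<one>" for a
    proof -
      have "a \<otimes> y = y \<otimes> a" using that commutator_eq_one_iff by simp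
      then have "inv y \<otimes> (a \<otimes> y) \<otimes> inv y = inv y \<otimes> (y \<otimes> a) \<otimes> inv y" by simp
      then have "inv y \<otimes> a = a \<otimes> inv y" using that(1) by (simp add: word_simps)
      then show ?thesis using that(1) commutator_eq_one_iff[of a "inv y"] by simp
    qed
    fix j :: nat assume j: "3 \<le> j"
    have \<sigma>: "\<sigma> j \<in> carrier G" "\<sigma> (Suc j) \<in> carrier G" "\<eta> (\<sigma> j) = \<one>" "\<eta> (\<sigma> (Suc j)) = \<one>"
      using \<sigma>_D[of j] \<sigma>_D[of "Suc j"] j D_closed M.\<eta>_\<sigma>[of j] M.\<eta>_\<sigma>[of "Suc j"] by simp_all
    have "commutator G (\<sigma> j) (x \<otimes> inv y) = conj_by (inv y) (\<sigma> (Suc j))"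
      using commutator_mult_right[of "\<sigma> j" x "inv y"] \<sigma> sigma_Suc[OF j] fix_inv[OF \<sigma>(1,3)] by simp
    also have "\<dots> = \<sigma> (Suc j)"
      using conj_by_eq[of "\<sigma> (Suc j)" "inv y"] \<sigma> fix_inv[OF \<sigma>(2,4)] by simp
    finally show "\<exists>a\<in>D. commutator G a (x \<otimes> inv y) = \<sigma> (Suc j)" using \<sigma>_D[OF j] by blast
    have \<tau>: "\<tau> j \<in> D" "\<tau> (Suc j) \<in> D" "\<tau> j \<in> carrier G" "\<tau> (Suc j) \<in> carrier G"
      "\<xi> (\<tau> j) = \<one>" "\<xi> (\<tau> (Suc j)) = \<one>"
      using \<tau>_D[of j] \<tau>_D[of "Suc j"] j D_closed M.\<xi>_\<tau>[of j] M.\<xi>_\<tau>[of "Suc j"] by simp_all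
    \<comment> \<open>The \<open>\<tau>\<close>-chain is moved by the inverse of \<open>y\<close>; this preimage compensates for the direction.\<close>
    define a where "a = inv (conj_by y (\<tau> j))"
    have t: "conj_by y (\<tau> j) = \<tau> j \<otimes> \<tau> (Suc j)" using conj_by_eq[of "\<tau> j" y] \<tau> tau_Suc[OF j] by simp
    have aD: "a \<in> D" unfolding a_def t using \<tau> by (intro D_inv D_mult)
    have "\<xi> (conj_by y (\<tau> j)) = \<one>" unfolding t using commutator_hom[OF x_closed \<tau>(1,2)] \<tau> by simp
    then have "\<xi> a = \<one>"
      using commutator_hom[OF x_closed aD, of "conj_by y (\<tau> j)"] D_mult[OF \<tau>(1,2)] D_closed[OF D_mult[OF \<tau>(1,2)]]
        D_closed[OF aD] commutator_one(2)[OF x_closed] unfolding t a_def by simp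
    then have "commutator G a (x \<otimes> inv y) = commutator G a (inv y)"
      using commutator_mult_right[of a x "inv y"] D_closed[OF aD] by simp
    also have "\<dots> = (\<tau> j \<otimes> \<tau> (Suc j)) \<otimes> inv (\<tau> j)"
      unfolding t[symmetric] using \<tau>(3) by (simp add: a_def word_simps)
    also have "\<dots> = \<tau> (Suc j)" using D_commute[OF \<tau>(1,2)] \<tau> by (simp add: m_assoc)
    finally show "\<exists>a\<in>D. commutator G a (x \<otimes> inv y) = \<tau> (Suc j)" using aD by blast
  qed simp
  then show ?thesis by (simp add: maximal_subgroup_def)
qed

end

section \<open>Stabilization and polarization\<close>

context group
begin

lemma kernel_natural_projection:
  assumes "N \<lhd> G"
  shows "kernel G (G Mod N) (natural_projection G N) = N"
proof -
  note sg = normal_imp_subgroup[OF assms]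
  have "N #> g = N \<longleftrightarrow> g \<in> N" if "g \<in> carrier G" for g
    using coset_join1[OF _ that sg] coset_join2[OF that sg] by blast
  then show ?thesis
    using subgroup.mem_carrier[OF sg] by (auto simp: kernel_def natural_projection_def FactGroup_def)
qed

lemma carrier_subgroup_generated_eq:
  assumes "subgroup H G"
  shows "subgroup_generated G H = G\<lparr>carrier := H\<rparr>"
proof -
  have "carrier G \<inter> H = H" using subgroup.subset[OF assms] by blast
  moreover have "generate G H = H"
    using generate_subgroup_incl[OF order_refl assms] generate.incl[of _ H G] by blast
  ultimately show ?thesis by (simp add: subgroup_generated_def)
qed

lemma cyclic_subgroupD:
  assumes H: "subgroup H G" and cyc: "cyclic_subgroup G H"
  obtains z where "z \<in> H" "H = generate G {z}"
proof -
  obtain z where z: "z \<in> carrier (subgroup_generated G H)"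
    and eq: "subgroup_generated (subgroup_generated G H) {z} = subgroup_generated G H"
    using cyc unfolding cyclic_subgroup_def cyclic_group_def by blast
  have zH: "z \<in> H" using z carrier_subgroup_generated_eq[OF H] by simp
  have "carrier (subgroup_generated (subgroup_generated G H) {z}) = H"
    unfolding eq using carrier_subgroup_generated_eq[OF H] by simp
  then have "generate (G\<lparr>carrier := H\<rparr>) {z} = H"
    using zH by (simp add: carrier_subgroup_generated carrier_subgroup_generated_eq[OF H])
  then have "H = generate G {z}" using zH generate_consistent[OF _ H, of "{z}"] by simp
  then show ?thesis by (rule that[OF zH])
qed

text \<open>A bicyclic group with invariant factors \<open>k\<close> and \<open>l\<close> has order at least 4, since \<open>1 < k \<le> l\<close>, or is
  infinite for \<open>l = 0\<close>.\<close>

lemma not_bicyclic_card_3: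
  assumes H: "subgroup H G" and card: "card H = 3"
  shows "\<not> bicyclic_subgroup G H"
proof
  assume "bicyclic_subgroup G H"
  then obtain k l :: nat where kl: "1 < k" "k dvd l"
    and iso: "subgroup_generated G H \<cong> integer_mod_group k \<times>\<times> integer_mod_group l"
    unfolding bicyclic_subgroup_def by blast
  have "card (carrier (integer_mod_group k \<times>\<times> integer_mod_group l)) = 3"
    using iso_same_card[OF iso] card carrier_subgroup_generated_eq[OF H] by simp
  then have kl3: "k * l = 3"
    using kl by (cases "l = 0") (auto simp: carrier_integer_mod_group card_cartesian_product)
  obtain q where q: "l = k * q" using kl(2) by blast
  have "0 < q" using kl3 q by (cases q) simp_all
  then have "2 * (2 * 1) \<le> k * (k * q)" using kl(1) by (intro mult_le_mono) simp_all
  then show False using kl3 q by simp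
qed

end

context metabelian_chain_group
begin

lemma gamma_c_subgroup: "subgroup (\<gamma> c) G"
  by (rule normal_imp_subgroup[OF lower_central_normal]) (use c_ge in simp)

lemma generate_\<sigma>: "generate AG {\<sigma> c} = generate G {\<sigma> c}"
  and generate_\<sigma>_\<tau>: "generate AG {\<sigma> c, \<tau> e} = generate G {\<sigma> c, \<tau> e}"
  and generate_\<tau>: "generate AG {\<tau> (Suc e)} = generate G {\<tau> (Suc e)}"
  using \<sigma>_D[of c] \<tau>_D[of e] \<tau>_D[of "Suc e"] c_ge e_ge by (intro generate_AG; simp)+

lemma generate_\<sigma>_psubset: "generate G {\<sigma> c} \<subset> generate G {\<sigma> c, \<tau> e}"
proof
  show "generate G {\<sigma> c} \<subseteq> generate G {\<sigma> c, \<tau> e}" by (rule mono_generate) simp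
  show "generate G {\<sigma> c} \<noteq> generate G {\<sigma> c, \<tau> e}"
    using M.\<tau>_e_notin generate.incl[of "\<tau> e" "{\<sigma> c, \<tau> e}" G] unfolding generate_\<sigma> by auto
qed

text \<open>Here \<open>\<gamma> c\<close> has order 9 and exponent 3.\<close>

lemma not_cyclic_gamma_c:
  assumes "e = c"
  shows "\<not> cyclic_subgroup G (\<gamma> c)"
proof
  assume "cyclic_subgroup G (\<gamma> c)"
  then obtain z where z: "z \<in> \<gamma> c" and eq: "\<gamma> c = generate G {z}"
    using cyclic_subgroupD[OF gamma_c_subgroup] by blast
  have zD: "z \<in> D" using z gamma_subset_D[of c] c_ge by auto
  have AG: "\<gamma> c = generate AG (insert z {\<one>})"
    using eq generate_AG[of "{z}"] M.generate_insert_one[of z] zD by simp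
  have "z [^] (3::nat) = \<one>" using M.cube_mem_\<Gamma>[of c z] z class_Suc c_ge by (simp add: pow_AG)
  then have "card (\<gamma> c) \<le> 3"
    using M.card_generate_insert_cube[OF M.triv_subgroup, of z] zD AG
    by (cases "z = \<one>") (simp_all add: pow_AG generate_AG[of "{\<one>}"] generate_one)
  then show False using M.card_\<Gamma>_c assms by simp
qed

abbreviation P :: "nat set" where "P \<equiv> Pol G (G Mod \<gamma> c) (natural_projection G (\<gamma> c)) U"
abbreviation S :: "nat set" where "S \<equiv> Stb G (G Mod \<gamma> c) (natural_projection G (\<gamma> c)) U"

lemma stabilized_iff:
  shows "\<gamma> c \<subseteq> derived G (U 1) \<longleftrightarrow> e < c \<and> \<tau> (Suc e) \<noteq> \<one>"
    and "\<gamma> c \<subseteq> derived G (U 2) \<longleftrightarrow> e < c"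
  using M.\<Gamma>_c_image_\<eta>_iff M.\<Gamma>_c_image_\<xi>_iff unfolding derived_U_1 derived_U_2 by simp_all

lemma Pol_Stb_eq:
  shows "P = {i \<in> {1, 2, 3, 4}. \<not> \<gamma> c \<subseteq> derived G (U i)}"
    and "S = {i \<in> {1, 2, 3, 4}. \<gamma> c \<subseteq> derived G (U i)}"
proof -
  have "kernel G (G Mod \<gamma> c) (natural_projection G (\<gamma> c)) = \<gamma> c"
    by (rule kernel_natural_projection[OF lower_central_normal]) (use c_ge in simp)
  moreover have "{1..4::nat} = {1, 2, 3, 4}" by auto
  ultimately show "P = {i \<in> {1, 2, 3, 4}. \<not> \<gamma> c \<subseteq> derived G (U i)}"
    and "S = {i \<in> {1, 2, 3, 4}. \<gamma> c \<subseteq> derived G (U i)}"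
    by (simp_all only: Pol_def Stb_def)
qed

lemma bipolar_case:
  assumes "e = c"
  shows "\<gamma> c = generate G {\<sigma> c, \<tau> e}" "center G = \<gamma> c" "P = {1, 2}" "S = {3, 4}"
proof -
  show "\<gamma> c = generate G {\<sigma> c, \<tau> e}" using M.\<Gamma>_c_bicyclic assms generate_\<sigma>_\<tau> by simp
  show "center G = \<gamma> c" using center_eq M.fixed_cases assms by simp
  show "P = {1, 2}" "S = {3, 4}"
    unfolding Pol_Stb_eq
    using stabilized_iff gamma_c_subset_derived_U_3 gamma_c_subset_derived_U_4 assms by auto
qed

lemma unipolar_case:
  assumes "e < c" "\<tau> (Suc e) = \<one>"
  shows "\<gamma> c = generate G {\<sigma> c}" "center G = generate G {\<sigma> c, \<tau> e}" "P = {1}" "S = {2, 3, 4}"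
proof -
  show "\<gamma> c = generate G {\<sigma> c}" using M.\<Gamma>_c_cyclic assms generate_\<sigma> by simp
  show "center G = generate G {\<sigma> c, \<tau> e}" using center_eq M.fixed_cases assms generate_\<sigma>_\<tau> by simp
  show "P = {1}" "S = {2, 3, 4}"
    unfolding Pol_Stb_eq
    using stabilized_iff gamma_c_subset_derived_U_3 gamma_c_subset_derived_U_4 assms by auto
qed

lemma nilpolar_case:
  assumes "e < c" "\<tau> (Suc e) \<noteq> \<one>"
  shows "\<gamma> c = generate G {\<sigma> c}" "\<gamma> c = generate G {\<tau> (Suc e)}" "center G = \<gamma> c"
    "P = {}" "S = {1, 2, 3, 4}"
proof -
  show "\<gamma> c = generate G {\<sigma> c}" using M.\<Gamma>_c_cyclic assms generate_\<sigma> by simp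
  show "\<gamma> c = generate G {\<tau> (Suc e)}" using M.\<Gamma>_c_gen_\<tau> assms generate_\<tau> by simp
  show "center G = \<gamma> c" using center_eq M.fixed_cases assms by simp
  show "P = {}" "S = {1, 2, 3, 4}"
    unfolding Pol_Stb_eq
    using stabilized_iff gamma_c_subset_derived_U_3 gamma_c_subset_derived_U_4 assms by auto
qed

lemma not_bicyclic_gamma_c: "e < c \<Longrightarrow> \<not> bicyclic_subgroup G (\<gamma> c)"
  using not_bicyclic_card_3[OF gamma_c_subgroup] M.card_\<Gamma>_c by simp

end

lemma nilpotency_class_unique:
  assumes "has_nilpotency_class G c" "has_nilpotency_class G d"
  shows "c = d"
  using assms unfolding has_nilpotency_class_def by (metis linorder_neqE_nat)

theorem theorem6p1:
  fixes G :: "('a, 'b) monoid_scheme" and n m e :: nat and x y :: 'a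
  defines "\<gamma> \<equiv> lower_central G (m - 1)"
    and "\<zeta> \<equiv> center G"
    and "\<sigma> \<equiv> sigma G x y"
    and "\<tau> \<equiv> tau G x y"
    and "P \<equiv> Pol G (G Mod lower_central G (m - 1))
               (natural_projection G (lower_central G (m - 1))) (maximal_subgroup G x y)"
    and "S \<equiv> Stb G (G Mod lower_central G (m - 1))
               (natural_projection G (lower_central G (m - 1))) (maximal_subgroup G x y)"
  assumes "group G"
    and "order G = 3 ^ n"
    and "metabelian G"
    and "has_nilpotency_class G (m - 1)" and "m - 1 \<ge> 4"
    and "has_coclass 3 G (e - 1)" and "e - 1 \<ge> 2"
    and "4 \<le> m" and "m < n" and "n \<le> 2 * m - 3"
    and "G Mod derived G (carrier G) \<cong> integer_mod_group 3 \<times>\<times> integer_mod_group 3"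
    and "selected_generators G m x y"
  shows
    "(bicyclic_subgroup G \<gamma> \<and> bicyclic_subgroup G \<zeta> \<and> \<gamma> = \<zeta> \<longrightarrow>
        bipolarization P \<and> partial_stabilization S) \<and>
     (P = {1, 2} \<and> S = {3, 4} \<longleftrightarrow>
        \<gamma> = generate G {\<sigma> (m - 1), \<tau> e} \<and> generate G {\<sigma> (m - 1), \<tau> e} = \<zeta>) \<and>

     (cyclic_subgroup G \<gamma> \<and> bicyclic_subgroup G \<zeta> \<longrightarrow>
        unipolarization P \<and> partial_stabilization S) \<and>
     (P = {1} \<and> S = {2, 3, 4} \<longleftrightarrow>
        \<gamma> = generate G {\<sigma> (m - 1)} \<and> generate G {\<sigma> (m - 1)} \<subset> \<zeta> \<and>
        \<zeta> = generate G {\<sigma> (m - 1), \<tau> e}) \<and>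

     (cyclic_subgroup G \<gamma> \<and> cyclic_subgroup G \<zeta> \<and> \<gamma> = \<zeta> \<longrightarrow>
        nilpolarization P \<and> total_stabilization S) \<and>
     (P = {} \<and> S = {1, 2, 3, 4} \<longleftrightarrow>
        \<gamma> = generate G {\<sigma> (m - 1)} \<and> generate G {\<sigma> (m - 1)} = generate G {\<tau> (e + 1)} \<and>
        generate G {\<tau> (e + 1)} = \<zeta>)"
proof -
  define c where "c = m - 1"
  have m: "m = Suc c" using \<open>4 \<le> m\<close> by (simp add: c_def)
  obtain n' c' where "order G = 3 ^ n'" "has_nilpotency_class G c'" "n' = c' + (e - 1)"
    using \<open>has_coclass 3 G (e - 1)\<close> unfolding has_coclass_def by blast
  then have ord: "order G = 3 ^ (c + (e - 1))"
    using nilpotency_class_unique[OF \<open>has_nilpotency_class G (m - 1)\<close>] by (simp add: c_def)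
  then have "(3::nat) ^ n = 3 ^ (c + (e - 1))" using \<open>order G = 3 ^ n\<close> by simp
  then have n: "n = c + (e - 1)" by (subst (asm) power_inject_exp) simp_all
  have cls: "lower_central G (Suc c) = {\<one>\<^bsub>G\<^esub>}" "lower_central G c \<noteq> {\<one>\<^bsub>G\<^esub>}"
  proof -
    have c: "c - 1 < c" "c - 1 + 1 = c" using \<open>m - 1 \<ge> 4\<close> by (simp_all add: c_def)
    have "has_nilpotency_class G c" using \<open>has_nilpotency_class G (m - 1)\<close> by (simp only: c_def)
    then have "lower_central G (c + 1) = {\<one>\<^bsub>G\<^esub>}" "lower_central G (c - 1 + 1) \<noteq> {\<one>\<^bsub>G\<^esub>}"
      using c(1) unfolding has_nilpotency_class_def by blast+
    then show "lower_central G (Suc c) = {\<one>\<^bsub>G\<^esub>}" "lower_central G c \<noteq> {\<one>\<^bsub>G\<^esub>}"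
      unfolding c(2) by simp_all
  qed
  have ab: "order (G Mod derived G (carrier G)) = 9"
    using iso_same_card[OF \<open>G Mod derived G (carrier G) \<cong> _\<close>]
    by (simp add: order_def carrier_integer_mod_group card_cartesian_product)
  interpret L: metabelian_chain_group G x y c e
  proof (intro metabelian_chain_group.intro metabelian_chain_group_axioms.intro)
    show "order G = 3 ^ (c + e - 1)" using ord \<open>e - 1 \<ge> 2\<close> by simp
    show "4 \<le> c" using \<open>m - 1 \<ge> 4\<close> by (simp add: c_def)
    show "3 \<le> e" using \<open>e - 1 \<ge> 2\<close> by simp
    show "e \<le> c" using \<open>n \<le> 2 * m - 3\<close> \<open>4 \<le> m\<close> \<open>e - 1 \<ge> 2\<close> n m by simp
    show "selected_generators G (Suc c) x y" using \<open>selected_generators G m x y\<close> m by simp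
  qed (fact \<open>group G\<close> \<open>metabelian G\<close> cls ab)+
  define g1 g2 g3 where "g1 = generate G {\<sigma> (m - 1)}" and "g2 = generate G {\<sigma> (m - 1), \<tau> e}"
    and "g3 = generate G {\<tau> (e + 1)}"
  note g_defs = this
  have eqs: "\<gamma> = lower_central G c" "\<zeta> = center G" "P = L.P" "S = L.S"
    "g1 = generate G {sigma G x y c}" "g2 = generate G {sigma G x y c, tau G x y e}"
    "g3 = generate G {tau G x y (Suc e)}"
    unfolding \<gamma>_def \<zeta>_def P_def S_def g_defs \<sigma>_def \<tau>_def c_def by simp_all
  have four: "{1..4::nat} = {1, 2, 3, 4}" by auto
  have pol: "bipolarization {1, 2}" "unipolarization {1}" "nilpolarization {}"
    by (simp_all add: bipolarization_def unipolarization_def nilpolarization_def)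
  have "{2, 3, 4} \<noteq> {1, 2, 3, 4::nat}"
  proof
    assume "{2, 3, 4} = {1, 2, 3, 4::nat}"
    then have "(1::nat) \<in> {2, 3, 4}" by blast
    then show False by simp
  qed
  then have stab: "partial_stabilization {3, 4}" "partial_stabilization {2, 3, 4}"
    "total_stabilization {1, 2, 3, 4}"
    unfolding partial_stabilization_def total_stabilization_def four by auto
  have ne: "{1, 2} \<noteq> {1::nat}" by auto
  have strict: "g1 \<subset> g2" unfolding eqs by (rule L.generate_\<sigma>_psubset)
  consider "e = c" | "e < c" "tau G x y (Suc e) = \<one>\<^bsub>G\<^esub>" | "e < c" "tau G x y (Suc e) \<noteq> \<one>\<^bsub>G\<^esub>"
    using L.e_le by linarith
  then show ?thesis
  proof cases
    case 1
    have "\<gamma> = g2" "\<zeta> = \<gamma>" "P = {1, 2}" "S = {3, 4}" "\<not> cyclic_subgroup G \<gamma>"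
      unfolding eqs by (rule L.bipolar_case[OF 1] L.not_cyclic_gamma_c[OF 1])+
    then show ?thesis using strict pol stab ne unfolding g_defs[symmetric] by auto
  next
    case 2
    have "\<gamma> = g1" "\<zeta> = g2" "P = {1}" "S = {2, 3, 4}" "\<not> bicyclic_subgroup G \<gamma>"
      unfolding eqs by (rule L.unipolar_case[OF 2] L.not_bicyclic_gamma_c[OF 2(1)])+
    then show ?thesis using strict pol stab ne unfolding g_defs[symmetric] by auto
  next
    case 3
    have "\<gamma> = g1" "\<gamma> = g3" "\<zeta> = \<gamma>" "P = {}" "S = {1, 2, 3, 4}" "\<not> bicyclic_subgroup G \<gamma>"
      unfolding eqs by (rule L.nilpolar_case[OF 3] L.not_bicyclic_gamma_c[OF 3(1)])+
    then show ?thesis using strict pol stab unfolding g_defs[symmetric] by auto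
  qed
qed

end
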